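(* Let $h>0$, $0<\alpha\le0.1$, $0<\lambda_v,\lambda_h<1$. Consider the perturbed square camera grid $\widehat{\mathcal S}=\{\hat s_{ij}=(ih+a_{ij},\,jh+b_{ij},\,h+c_{ij}): i,j\in\mathbb Z\}$ of resolution $\delta_d=h$, where the horizontal perturbations satisfy $|a_{ij}|,|b_{ij}|\le\lambda_h h$ and the vertical perturbations satisfy $|c_{ij}|\le\lambda_v h$. For every target $g\in\mathcal G$, $$\overline\varepsilon(g)=\min_{\hat s,\hat s'\in\widehat{\mathcal S}}\varepsilon(g,\{\hat s,\hat s'\})\;\le\;2.47\,\frac{1+\lambda_v}{1-\lambda_h}\,\varepsilon(g,\mathcal S).$$
   Context: Work in $\mathbb{R}^3$ with coordinates $(x,y,z)$. The ground plane is $\mathcal G=\{z=0\}$ and the (unperturbed) viewing plane is $\mathcal S=\{z=h\}$. For a point $s$ and unit vector $u$, the cone $K(s,u)=\{s+rv:\ r\ge0,\ |v|=1,\ \angle(v,u)\le\alpha\}$ (apex $s$, half-angle $\alpha$). For target $g$ and camera $s$, $\mathcal K(g,s)$ is the set of all cones $K(s,u)$ containing $g$. For any set $C$ of camera locations, $\varepsilon(g,C)=\sup\{\operatorname{diam}(\bigcap_{s\in C}K_s): K_s\in\mathcal K(g,s)\ \forall s\in C\}$. *)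

theory Defs
  imports "HOL-Analysis.Analysis"
begin

type_synonym point = "real ^ 3"

definition vec_angle :: "point \<Rightarrow> point \<Rightarrow> real" where
  "vec_angle v u = arccos ((v \<bullet> u) / (norm v * norm u))"

definition cone3 :: "real \<Rightarrow> point \<Rightarrow> point \<Rightarrow> point set" where
  "cone3 \<alpha> s u = {s + r *\<^sub>R v | r v. r \<ge> 0 \<and> norm v = 1 \<and> vec_angle v u \<le> \<alpha>}"

definition cones_containing :: "real \<Rightarrow> point \<Rightarrow> point \<Rightarrow> point set set" where
  "cones_containing \<alpha> g s = {cone3 \<alpha> s u | u. norm u = 1 \<and> g \<in> cone3 \<alpha> s u}"

text \<open>Diameter with values in the extended reals (unbounded sets have diameter \<infinity>).\<close>
definition ediam :: "point set \<Rightarrow> ereal" where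
  "ediam S = (SUP x\<in>S. SUP y\<in>S. ereal (dist x y))"

definition loc_err :: "real \<Rightarrow> point \<Rightarrow> point set \<Rightarrow> ereal" where
  "loc_err \<alpha> g C = (SUP K \<in> {K. \<forall>s\<in>C. K s \<in> cones_containing \<alpha> g s}. ediam (\<Inter>s\<in>C. K s))"

end

theory Submission
  imports Defs
begin

text \<open>
  Write \<open>T = tan \<alpha>\<close> and \<open>\<beta> = 4.94 h (1 + lam_v) / (1 - lam_h)\<close>. Cameras in the plane cannot separate the target
  from the point \<open>4 T h / (1 - T)\<^sup>2\<close> vertically below it, so it suffices to find two cameras whose error is at most
  \<open>2 T \<beta> / (1 - T)\<^sup>2\<close>.

  If \<open>p\<close> and \<open>q\<close> lie in a cone with apex \<open>s\<close> and \<open>n\<close> is a unit vector orthogonal to \<open>p - q\<close>, then the width of the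
  cone near the target \<open>g\<close> bounds \<open>norm (p - q)\<close> by roughly \<open>2 T R / cos \<theta>\<close>, where \<open>R\<close> is the distance from \<open>g\<close> to \<open>s\<close>
  and \<open>\<theta>\<close> the angle between \<open>n\<close> and \<open>s - g\<close>. Fix directions \<open>\<nu>\<close> and \<open>\<nu>'\<close>. Some \<open>n\<close> in their span is orthogonal
  to \<open>p - q\<close>, and up to sign it lies between \<open>\<nu>\<close> and \<open>\<nu>'\<close> or between \<open>\<nu>\<close> and \<open>- \<nu>'\<close>. Hence the pair is good enough as
  soon as one camera satisfies the width bound for \<open>\<nu>\<close> and \<open>\<nu>'\<close> and the other one for \<open>\<nu>\<close> and \<open>- \<nu>'\<close>.
  Each of these four conditions concerns a single camera and is convex in its position, so for all
  perturbations at once it needs to be checked only at the corners of the perturbation box. Subdividing the ranges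
  of \<open>lam_h\<close>, \<open>lam_v\<close> and of the position of \<open>g\<close> relative to the grid leaves finitely many cases, each
  settled by one pair of grid points with suitable \<open>\<nu>\<close> and \<open>\<nu>'\<close>.
\<close>

section \<open>Cones and the lower bound for the camera plane\<close>

lemma mem_cone3_iff:
  fixes u :: point
  assumes "norm u = 1" "0 \<le> \<alpha>" "\<alpha> \<le> pi"
  shows "p \<in> cone3 \<alpha> s u \<longleftrightarrow> cos \<alpha> * norm (p - s) \<le> (p - s) \<bullet> u"
proof
  assume "p \<in> cone3 \<alpha> s u"
  then obtain r v where rv: "p = s + r *\<^sub>R v" "r \<ge> 0" "norm v = 1" "vec_angle v u \<le> \<alpha>"
    by (auto simp: cone3_def)
  have "\<bar>v \<bullet> u\<bar> \<le> 1"
    using Cauchy_Schwarz_ineq2[of v u] rv(3) assms(1) by simp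
  then have "cos (vec_angle v u) = v \<bullet> u"
    using rv(3) assms(1) by (simp add: vec_angle_def cos_arccos_abs)
  moreover have "0 \<le> vec_angle v u"
    using \<open>\<bar>v \<bullet> u\<bar> \<le> 1\<close> rv(3) assms(1) by (simp add: vec_angle_def arccos_lbound abs_le_iff)
  ultimately have "cos \<alpha> \<le> v \<bullet> u"
    using cos_monotone_0_pi_le[of "vec_angle v u" \<alpha>] rv(4) assms by simp
  then show "cos \<alpha> * norm (p - s) \<le> (p - s) \<bullet> u"
    using rv by (simp add: mult.commute mult_left_mono)
next
  assume *: "cos \<alpha> * norm (p - s) \<le> (p - s) \<bullet> u"
  show "p \<in> cone3 \<alpha> s u"
  proof (cases "p = s")
    case True
    have "u \<bullet> u = 1" using assms(1) by (simp add: dot_square_norm)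
    then have "p = s + 0 *\<^sub>R u \<and> (0::real) \<ge> 0 \<and> norm u = 1 \<and> vec_angle u u \<le> \<alpha>"
      using True assms by (simp add: vec_angle_def)
    then show ?thesis unfolding cone3_def by blast
  next
    case False
    define v where "v = (1 / norm (p - s)) *\<^sub>R (p - s)"
    have n: "norm (p - s) > 0" using False by simp
    have v: "norm v = 1" "p = s + norm (p - s) *\<^sub>R v"
      using n by (simp_all add: v_def)
    have "v \<bullet> u = (p - s) \<bullet> u / norm (p - s)" by (simp add: v_def)
    then have "cos \<alpha> \<le> v \<bullet> u" using * n by (simp add: pos_le_divide_eq)
    moreover have "v \<bullet> u \<le> 1"
      using Cauchy_Schwarz_ineq2[of v u] v(1) assms(1) by simp
    moreover have "-1 \<le> cos \<alpha>" by simp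
    ultimately have "arccos (v \<bullet> u) \<le> arccos (cos \<alpha>)"
      by (intro arccos_le_arccos) auto
    then have "vec_angle v u \<le> \<alpha>"
      using v(1) assms by (simp add: vec_angle_def arccos_cos)
    then show ?thesis using v n unfolding cone3_def by fastforce
  qed
qed

text \<open>The point at depth \<open>k\<^sup>2 h\<close> below the camera plane, \<open>k = (1 + tan \<alpha>) / (1 - tan \<alpha>)\<close>, is seen from
  every camera within an angle \<open>2 \<alpha>\<close> of the target at depth \<open>h\<close>; the worst camera is at horizontal
  distance \<open>k h\<close>.\<close>

lemma cos_vertical_segment_ge:
  fixes a h k :: real
  assumes "a \<ge> 0" "k > 0" "h > 0"
  shows "2 * k / (1 + k\<^sup>2) * (sqrt (a + h\<^sup>2) * sqrt (a + (k\<^sup>2 * h)\<^sup>2)) \<le> a + k\<^sup>2 * h\<^sup>2"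
proof -
  have "(a + k\<^sup>2 * h\<^sup>2)\<^sup>2 * (1 + k\<^sup>2)\<^sup>2 - 4 * k\<^sup>2 * ((a + h\<^sup>2) * (a + (k\<^sup>2 * h)\<^sup>2))
      = ((k\<^sup>2 - 1) * (a - k\<^sup>2 * h\<^sup>2))\<^sup>2"
    by algebra
  then have "4 * k\<^sup>2 * ((a + h\<^sup>2) * (a + (k\<^sup>2 * h)\<^sup>2)) \<le> ((a + k\<^sup>2 * h\<^sup>2) * (1 + k\<^sup>2))\<^sup>2"
    by (simp add: power_mult_distrib) (metis diff_ge_0_iff_ge zero_le_power2 power_mult_distrib)
  then have "sqrt (4 * k\<^sup>2 * ((a + h\<^sup>2) * (a + (k\<^sup>2 * h)\<^sup>2))) \<le> (a + k\<^sup>2 * h\<^sup>2) * (1 + k\<^sup>2)"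
    using assms by (intro real_le_lsqrt) auto
  moreover have "sqrt (4 * k\<^sup>2 * ((a + h\<^sup>2) * (a + (k\<^sup>2 * h)\<^sup>2)))
      = 2 * k * (sqrt (a + h\<^sup>2) * sqrt (a + (k\<^sup>2 * h)\<^sup>2))"
    using assms by (simp add: real_sqrt_mult)
  moreover have "1 + k\<^sup>2 > 0" by (simp add: add_pos_nonneg)
  ultimately show ?thesis by (simp add: field_simps)
qed

lemma double_angle_tan:
  fixes \<alpha> :: real
  assumes "0 < \<alpha>" "\<alpha> < pi / 4"
  defines "k \<equiv> (1 + tan \<alpha>) / (1 - tan \<alpha>)"
  shows "cos (2 * \<alpha>) = 2 * k / (1 + k\<^sup>2)" "k > 0"
proof -
  have c: "cos \<alpha> > 0" using assms by (intro cos_gt_zero_pi) auto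
  have t: "0 < tan \<alpha>" "tan \<alpha> < 1"
    using assms tan_gt_zero[of \<alpha>] tan_monotone[of \<alpha> "pi/4"] by (auto simp: tan_45)
  then show "k > 0" by (simp add: k_def)
  have "cos (2 * \<alpha>) = (1 - (tan \<alpha>)\<^sup>2) / (1 + (tan \<alpha>)\<^sup>2)"
    using cos_tan_half[of \<alpha>] c by simp
  also have "\<dots> = 2 * k / (1 + k\<^sup>2)"
  proof -
    have 1: "1 + k\<^sup>2 = 2 * (1 + (tan \<alpha>)\<^sup>2) / (1 - tan \<alpha>)\<^sup>2"
      using t by (simp add: k_def power_divide divide_simps) algebra
    show ?thesis unfolding 1 using t
      by (simp add: k_def divide_simps add_nonneg_eq_0_iff) algebra
  qed
  finally show "cos (2 * \<alpha>) = 2 * k / (1 + k\<^sup>2)" .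
qed

lemma exists_cone_containing_both:
  fixes a b s :: point
  assumes al: "0 < \<alpha>" "\<alpha> < pi / 4" and "a \<noteq> s" "b \<noteq> s"
    and ang: "cos (2 * \<alpha>) * (norm (a - s) * norm (b - s)) \<le> (a - s) \<bullet> (b - s)"
  obtains u where "norm u = 1" "a \<in> cone3 \<alpha> s u" "b \<in> cone3 \<alpha> s u"
proof -
  define x y where "x = (1 / norm (a - s)) *\<^sub>R (a - s)" and "y = (1 / norm (b - s)) *\<^sub>R (b - s)"
  have n: "norm (a - s) > 0" "norm (b - s) > 0" using assms by auto
  have xy: "x \<bullet> x = 1" "y \<bullet> y = 1" using n by (simp_all add: x_def y_def dot_square_norm power2_eq_square)
  have "x \<bullet> y = ((a - s) \<bullet> (b - s)) / (norm (a - s) * norm (b - s))" by (simp add: x_def y_def)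
  then have d: "cos (2 * \<alpha>) \<le> x \<bullet> y" using ang n by (simp add: pos_le_divide_eq)
  have c: "cos \<alpha> > 0" "cos (2 * \<alpha>) > 0" using al by (intro cos_gt_zero_pi; simp)+
  have nn: "(norm (x + y))\<^sup>2 = 2 + 2 * (x \<bullet> y)"
    by (simp add: power2_norm_eq_inner inner_add_left inner_add_right xy inner_commute)
  then have "(2 * cos \<alpha>)\<^sup>2 \<le> (norm (x + y))\<^sup>2"
    using d by (simp add: cos_double_cos power_mult_distrib)
  then have half: "2 * cos \<alpha> \<le> norm (x + y)" by (rule power2_le_imp_le) simp
  then have pos: "norm (x + y) > 0" using c by linarith
  define u where "u = (1 / norm (x + y)) *\<^sub>R (x + y)"
  have u: "norm u = 1" using pos by (simp add: u_def)
  have "x \<bullet> u = norm (x + y) / 2" "y \<bullet> u = norm (x + y) / 2"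
    using pos nn xy by (simp_all add: u_def inner_add_right inner_commute field_simps power2_eq_square)
  then have "cos \<alpha> \<le> x \<bullet> u" "cos \<alpha> \<le> y \<bullet> u" using half by simp_all
  then have "cos \<alpha> * norm (a - s) \<le> (a - s) \<bullet> u" "cos \<alpha> * norm (b - s) \<le> (b - s) \<bullet> u"
    using n by (simp_all add: x_def y_def pos_le_divide_eq)
  moreover have "0 \<le> \<alpha>" "\<alpha> \<le> pi" using al by auto
  ultimately show ?thesis using that[of u] u by (simp add: mem_cone3_iff)
qed

lemma norm_point: "norm (x :: point) = sqrt ((x$1)\<^sup>2 + (x$2)\<^sup>2 + (x$3)\<^sup>2)"
  by (simp add: norm_eq_sqrt_inner inner_vec_def sum_3 power2_eq_square)

lemma loc_err_plane_ge:
  fixes g :: point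
  assumes al: "0 < \<alpha>" "\<alpha> < pi / 4" and h: "h > 0" and g: "g $ 3 = 0"
  shows "ereal (4 * tan \<alpha> * h / (1 - tan \<alpha>)\<^sup>2) \<le> loc_err \<alpha> g {x. x $ 3 = h}"
proof -
  define T where "T = tan \<alpha>"
  define k where "k = (1 + T) / (1 - T)"
  have T: "0 < T" "T < 1"
    using al tan_gt_zero[of \<alpha>] tan_monotone[of \<alpha> "pi/4"] by (auto simp: tan_45 T_def)
  have k: "cos (2 * \<alpha>) = 2 * k / (1 + k\<^sup>2)" "k > 0"
    using double_angle_tan[OF al] by (simp_all add: k_def T_def)
  define L where "L = 4 * T * h / (1 - T)\<^sup>2"
  have L: "L \<ge> 0" using T h by (simp add: L_def)
  have kL: "h + L = k\<^sup>2 * h"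
    using T by (simp add: L_def k_def power_divide divide_simps) algebra
  define q :: point where "q = g - vector [0, 0, L]"
  have ex: "\<exists>u. norm u = 1 \<and> g \<in> cone3 \<alpha> s u \<and> q \<in> cone3 \<alpha> s u" if "s $ 3 = h" for s
  proof -
    define a where "a = ((g - s)$1)\<^sup>2 + ((g - s)$2)\<^sup>2"
    have a: "a \<ge> 0" by (simp add: a_def)
    have c3: "(g - s)$3 = - h" "(q - s)$3 = - (k\<^sup>2 * h)"
      using that g kL by (simp_all add: q_def vector_3)
    have c12: "(q - s)$1 = (g - s)$1" "(q - s)$2 = (g - s)$2"
      by (simp_all add: q_def vector_3)
    have n: "norm (g - s) = sqrt (a + h\<^sup>2)" "norm (q - s) = sqrt (a + (k\<^sup>2 * h)\<^sup>2)"
      unfolding norm_point c3 c12 by (simp_all add: a_def)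
    have "(g - s) \<bullet> (q - s) = a + k\<^sup>2 * h\<^sup>2"
      unfolding inner_vec_def sum_3 c3 c12 by (simp add: a_def power2_eq_square)
    then have "cos (2 * \<alpha>) * (norm (g - s) * norm (q - s)) \<le> (g - s) \<bullet> (q - s)"
      using cos_vertical_segment_ge[OF a k(2) h] by (simp add: k(1) n)
    moreover have "g \<noteq> s" "q \<noteq> s" using c3 h k(2) by auto
    ultimately show ?thesis using exists_cone_containing_both[OF al, of g s q] by blast
  qed
  then obtain u where u: "\<And>s. s $ 3 = h \<Longrightarrow> norm (u s) = 1 \<and> g \<in> cone3 \<alpha> s (u s) \<and> q \<in> cone3 \<alpha> s (u s)"
    by metis
  define K where "K s = cone3 \<alpha> s (u s)" for s
  let ?S = "{x :: point. x $ 3 = h}"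
  have "ereal L = ereal (dist g q)"
    using L by (simp add: dist_norm q_def norm_point vector_3)
  also have "\<dots> \<le> ediam (\<Inter>s\<in>?S. K s)"
    unfolding ediam_def
    by (rule SUP_upper2[where i = g], use u in \<open>auto simp: K_def\<close>,
        rule SUP_upper2[where i = q], use u in \<open>auto simp: K_def\<close>)
  also have "\<dots> \<le> loc_err \<alpha> g ?S"
    unfolding loc_err_def by (rule SUP_upper) (use u in \<open>auto simp: K_def cones_containing_def\<close>)
  finally show ?thesis by (simp add: L_def T_def)
qed

section \<open>Error of a pair of cameras\<close>

lemma tan_le_of_le_tenth:
  fixes \<alpha> :: real
  assumes "0 < \<alpha>" "\<alpha> \<le> 0.1"
  shows "0 < tan \<alpha>" "tan \<alpha> \<le> 10051 / 100000" "0 < cos \<alpha>" "0 \<le> sin \<alpha>" "\<alpha> < pi / 4"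
proof -
  show q: "\<alpha> < pi / 4" using assms pi_gt3 by simp
  show c: "0 < cos \<alpha>" using assms q by (intro cos_gt_zero_pi) auto
  show "0 < tan \<alpha>" using assms q by (intro tan_gt_zero) auto
  show "0 \<le> sin \<alpha>" using assms q by (intro sin_ge_zero) auto
  have "cos \<alpha> = 1 - 2 * (sin (\<alpha> / 2))\<^sup>2" using cos_double_sin[of "\<alpha> / 2"] by simp
  moreover have "(sin (\<alpha> / 2))\<^sup>2 \<le> (\<alpha> / 2)\<^sup>2"
    by (rule abs_le_square_iff[THEN iffD1]) (rule abs_sin_x_le_abs_x)
  moreover have "(\<alpha> / 2)\<^sup>2 \<le> (1 / 20)\<^sup>2" using assms by (intro power_mono) auto
  ultimately have "cos \<alpha> \<ge> 995 / 1000" by (simp add: power2_eq_square)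
  moreover have "sin \<alpha> \<le> 1 / 10" using sin_x_le_x[of \<alpha>] assms by simp
  ultimately have "sin \<alpha> \<le> 10051 / 100000 * cos \<alpha>" by linarith
  then show "tan \<alpha> \<le> 10051 / 100000" using c by (simp add: tan_def divide_simps)
qed

lemma cone_transverse_le:
  fixes a u :: "'a::real_inner"
  assumes "norm u = 1" "cos \<alpha> * norm a \<le> a \<bullet> u" "cos \<alpha> > 0"
  shows "norm (a - (a \<bullet> u) *\<^sub>R u) \<le> \<bar>tan \<alpha>\<bar> * (a \<bullet> u)"
proof -
  have uu: "u \<bullet> u = 1" using assms(1) by (simp add: dot_square_norm)
  have au: "0 \<le> a \<bullet> u" using assms(2,3) by (meson mult_nonneg_nonneg norm_ge_zero less_imp_le order_trans)
  have "(norm (a - (a \<bullet> u) *\<^sub>R u))\<^sup>2 = (norm a)\<^sup>2 - (a \<bullet> u)\<^sup>2"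
    by (simp add: power2_norm_eq_inner inner_diff_left inner_diff_right uu inner_commute
        power2_eq_square[of "a \<bullet> u"])
  also have "\<dots> \<le> ((a \<bullet> u) / cos \<alpha>)\<^sup>2 - (a \<bullet> u)\<^sup>2"
    using assms by (intro diff_right_mono power_mono) (auto simp: field_simps)
  also have "\<dots> = (\<bar>tan \<alpha>\<bar> * (a \<bullet> u))\<^sup>2"
  proof -
    have "(tan \<alpha>)\<^sup>2 = 1 / (cos \<alpha>)\<^sup>2 - 1"
      using tan_sec[of \<alpha>] assms(3) by (simp add: power_inverse inverse_eq_divide power_one_over)
    then show ?thesis by (simp add: power_mult_distrib power_divide left_diff_distrib)
  qed
  finally show ?thesis by (rule power2_le_imp_le) (simp add: au)
qed

lemma bessel_two:
  fixes n u w :: "'a::real_inner"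
  assumes "norm u = 1" "norm n = 1" "n \<bullet> w = 0"
  shows "(w \<bullet> u)\<^sup>2 + (norm w)\<^sup>2 * (n \<bullet> u)\<^sup>2 \<le> (norm w)\<^sup>2"
proof (cases "w = 0")
  case False
  define z where "z = u - (n \<bullet> u) *\<^sub>R n - ((w \<bullet> u) / (w \<bullet> w)) *\<^sub>R w"
  have ww: "w \<bullet> w > 0" using False by simp
  have "0 \<le> z \<bullet> z" by simp
  also have "z \<bullet> z = 1 - (n \<bullet> u)\<^sup>2 - (w \<bullet> u)\<^sup>2 / (w \<bullet> w)"
  proof -
    have "u \<bullet> u = 1" "n \<bullet> n = 1" "w \<bullet> n = 0" "u \<bullet> n = n \<bullet> u" "u \<bullet> w = w \<bullet> u"
      using assms by (simp_all add: dot_square_norm inner_commute)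
    then show ?thesis
      using assms(3) ww by (simp add: z_def inner_diff_left inner_diff_right power2_eq_square)
  qed
  finally have "(w \<bullet> u)\<^sup>2 \<le> (w \<bullet> w) * (1 - (n \<bullet> u)\<^sup>2)"
    using ww by (simp add: field_simps)
  then show ?thesis by (simp add: power2_norm_eq_inner algebra_simps)
qed simp

lemma inner_ge_via_middle:
  fixes a b c :: "'a::real_inner"
  assumes "norm a = 1" "norm b = 1" "norm c = 1"
  shows "(a \<bullet> b) * (b \<bullet> c) - sqrt (1 - (a \<bullet> b)\<^sup>2) * sqrt (1 - (b \<bullet> c)\<^sup>2) \<le> a \<bullet> c"
proof -
  let ?p = "a - (a \<bullet> b) *\<^sub>R b" and ?q = "c - (b \<bullet> c) *\<^sub>R b"
  have n: "a \<bullet> a = 1" "b \<bullet> b = 1" "c \<bullet> c = 1" using assms by (simp_all add: dot_square_norm)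
  have "norm ?p = sqrt (1 - (a \<bullet> b)\<^sup>2)" "norm ?q = sqrt (1 - (b \<bullet> c)\<^sup>2)"
    by (simp_all add: norm_eq_sqrt_inner inner_diff_left inner_diff_right n inner_commute[of b a]
        inner_commute[of c b] power2_eq_square)
  moreover have "?p \<bullet> ?q = a \<bullet> c - (a \<bullet> b) * (b \<bullet> c)"
    by (simp add: inner_diff_left inner_diff_right n algebra_simps)
  ultimately show ?thesis using Cauchy_Schwarz_ineq2[of ?p ?q] by (simp add: abs_le_iff)
qed

lemma axis_inner_ge:
  fixes n u D :: "'a::real_inner"
  assumes "norm n = 1" "norm u = 1" "D \<noteq> 0" "x * norm D \<le> n \<bullet> D" "0 \<le> x"
    and "cos \<alpha> * norm D \<le> - (D \<bullet> u)" "0 \<le> cos \<alpha>" "0 \<le> sin \<alpha>"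
  shows "x * cos \<alpha> - sqrt (1 - x\<^sup>2) * sin \<alpha> \<le> - (n \<bullet> u)"
proof -
  define d where "d = (1 / norm D) *\<^sub>R D"
  have D: "norm D > 0" using assms by simp
  have d: "norm d = 1" using D by (simp add: d_def)
  have nd: "x \<le> n \<bullet> d" and du: "cos \<alpha> \<le> d \<bullet> (- u)"
    using assms(4,6) D by (simp_all add: d_def pos_le_divide_eq pos_le_minus_divide_eq)
  have le1: "n \<bullet> d \<le> 1" "d \<bullet> (- u) \<le> 1"
    using Cauchy_Schwarz_ineq2[of n d] Cauchy_Schwarz_ineq2[of d "-u"] assms d by (simp_all add: abs_le_iff)
  have s: "sin \<alpha> = sqrt (1 - (cos \<alpha>)\<^sup>2)"
    using assms(8) by (metis sin_squared_eq real_sqrt_abs abs_of_nonneg)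
  have "x * cos \<alpha> \<le> (n \<bullet> d) * (d \<bullet> (- u))"
    using nd du assms by (intro mult_mono) auto
  moreover have "sqrt (1 - (n \<bullet> d)\<^sup>2) * sqrt (1 - (d \<bullet> (- u))\<^sup>2) \<le> sqrt (1 - x\<^sup>2) * sin \<alpha>"
    unfolding s
  proof (intro mult_mono real_sqrt_le_mono diff_left_mono power_mono)
    show "0 \<le> sqrt (1 - x\<^sup>2)" using nd le1 assms(5) by (simp add: abs_square_le_1)
    show "0 \<le> sqrt (1 - (d \<bullet> (- u))\<^sup>2)" using du le1 assms(7)
      by (simp add: abs_square_le_1 del: inner_minus_right)
  qed (use nd du assms in auto)
  moreover have "(n \<bullet> d) * (d \<bullet> (- u)) - sqrt (1 - (n \<bullet> d)\<^sup>2) * sqrt (1 - (d \<bullet> (- u))\<^sup>2) \<le> n \<bullet> (- u)"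
    by (rule inner_ge_via_middle) (use assms d in auto)
  ultimately show ?thesis by simp
qed

lemma two_points_in_cone_bound:
  fixes s g p q n u :: point
  assumes al: "0 < \<alpha>" "\<alpha> \<le> 0.1" and u: "norm u = 1"
    and cone: "g \<in> cone3 \<alpha> s u" "p \<in> cone3 \<alpha> s u" "q \<in> cone3 \<alpha> s u"
    and n: "norm n = 1" "n \<bullet> (p - q) = 0"
    and x: "0 \<le> x" "x * norm (s - g) \<le> n \<bullet> (s - g)" and sg: "s \<noteq> g"
  shows "norm (p - q) * (x * cos \<alpha> - sqrt (1 - x\<^sup>2) * sin \<alpha>)
           \<le> tan \<alpha> * (2 * norm (s - g) + ((p - g) + (q - g)) \<bullet> u)"
    and "x * cos \<alpha> - sqrt (1 - x\<^sup>2) * sin \<alpha> \<le> - (n \<bullet> u)"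
proof -
  note a = tan_le_of_le_tenth[OF al]
  have lin: "cos \<alpha> * norm (y - s) \<le> (y - s) \<bullet> u" if "y \<in> cone3 \<alpha> s u" for y
    using that mem_cone3_iff[OF u, of \<alpha> y s] al pi_gt3 by simp
  show v: "x * cos \<alpha> - sqrt (1 - x\<^sup>2) * sin \<alpha> \<le> - (n \<bullet> u)"
  proof (rule axis_inner_ge[OF n(1) u _ x(2,1)])
    show "cos \<alpha> * norm (s - g) \<le> - ((s - g) \<bullet> u)"
      using lin[OF cone(1)] by (simp add: norm_minus_commute inner_diff_left)
  qed (use sg a in auto)
  define w where "w = p - q"
  have "norm w * - (n \<bullet> u) \<le> norm w * \<bar>n \<bullet> u\<bar>" by (intro mult_left_mono) auto
  also have "\<dots> \<le> norm (w - (w \<bullet> u) *\<^sub>R u)"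
  proof (rule power2_le_imp_le)
    have uu: "u \<bullet> u = 1" using u by (simp add: dot_square_norm)
    have "(norm (w - (w \<bullet> u) *\<^sub>R u))\<^sup>2 = (norm w)\<^sup>2 - (w \<bullet> u)\<^sup>2"
      by (simp add: power2_norm_eq_inner inner_diff_left inner_diff_right uu inner_commute
        power2_eq_square[of "u \<bullet> w"])
    then show "(norm w * \<bar>n \<bullet> u\<bar>)\<^sup>2 \<le> (norm (w - (w \<bullet> u) *\<^sub>R u))\<^sup>2"
      using bessel_two[OF u n(1), of w] n(2) by (simp add: w_def power_mult_distrib)
  qed simp
  also have "\<dots> = norm (((p - s) - ((p - s) \<bullet> u) *\<^sub>R u) - ((q - s) - ((q - s) \<bullet> u) *\<^sub>R u))"
    by (simp add: w_def algebra_simps inner_diff_left)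
  also have "\<dots> \<le> norm ((p - s) - ((p - s) \<bullet> u) *\<^sub>R u) + norm ((q - s) - ((q - s) \<bullet> u) *\<^sub>R u)"
    by (rule norm_triangle_ineq4)
  also have "\<dots> \<le> tan \<alpha> * ((p - s) \<bullet> u) + tan \<alpha> * ((q - s) \<bullet> u)"
    using cone_transverse_le[OF u lin[OF cone(2)] a(3)] cone_transverse_le[OF u lin[OF cone(3)] a(3)] a(1)
    by simp
  also have "\<dots> = tan \<alpha> * (2 * ((g - s) \<bullet> u) + ((p - g) + (q - g)) \<bullet> u)"
    by (simp only: inner_diff_left inner_add_left) algebra
  also have "\<dots> \<le> tan \<alpha> * (2 * norm (s - g) + ((p - g) + (q - g)) \<bullet> u)"
    using a(1) norm_cauchy_schwarz[of "g - s" u] u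
    by (intro mult_left_mono add_right_mono) (auto simp: norm_minus_commute)
  finally have "norm w * - (n \<bullet> u) \<le> tan \<alpha> * (2 * norm (s - g) + ((p - g) + (q - g)) \<bullet> u)" .
  moreover have "norm w * (x * cos \<alpha> - sqrt (1 - x\<^sup>2) * sin \<alpha>) \<le> norm w * - (n \<bullet> u)"
    using v by (intro mult_left_mono) auto
  ultimately show "norm (p - q) * (x * cos \<alpha> - sqrt (1 - x\<^sup>2) * sin \<alpha>)
           \<le> tan \<alpha> * (2 * norm (s - g) + ((p - g) + (q - g)) \<bullet> u)"
    unfolding w_def by linarith
qed

lemma point_in_cone_bound:
  fixes s g p n u :: point
  assumes al: "0 < \<alpha>" "\<alpha> \<le> 0.1" and u: "norm u = 1"
    and cone: "g \<in> cone3 \<alpha> s u" "p \<in> cone3 \<alpha> s u"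
    and n: "norm n = 1" "n \<bullet> (p - g) = 0"
    and x: "0 \<le> x" "x \<le> 1" "x * norm (s - g) \<le> n \<bullet> (s - g)" and sg: "s \<noteq> g"
    and v: "0 \<le> x * cos \<alpha> - sqrt (1 - x\<^sup>2) * sin \<alpha>"
  shows "norm (p - g) * (cos \<alpha> * (x * (1 - (tan \<alpha>)\<^sup>2) - 2 * sqrt (1 - x\<^sup>2) * tan \<alpha>))
           \<le> 2 * tan \<alpha> * norm (s - g)"
proof -
  note a = tan_le_of_le_tenth[OF al]
  define y where "y = sqrt (1 - x\<^sup>2)"
  have y: "0 \<le> y" "x\<^sup>2 + y\<^sup>2 = 1" using x by (simp_all add: y_def abs_square_le_1)
  define P where "P = p - g"
  define v where "v = x * cos \<alpha> - y * sin \<alpha>"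
  have v0: "0 \<le> v" "v \<le> - (n \<bullet> u)"
    using two_points_in_cone_bound(2)[OF al u cone(1,2,1) n x(1,3) sg] v by (simp_all add: v_def y_def)
  have sv: "1 - v\<^sup>2 = (x * sin \<alpha> + y * cos \<alpha>)\<^sup>2"
  proof -
    have "(x * sin \<alpha> + y * cos \<alpha>)\<^sup>2 + v\<^sup>2 = (x\<^sup>2 + y\<^sup>2) * ((sin \<alpha>)\<^sup>2 + (cos \<alpha>)\<^sup>2)"
      unfolding v_def by algebra
    then show ?thesis using y by simp
  qed
  have "(P \<bullet> u)\<^sup>2 \<le> (norm P)\<^sup>2 * (1 - (n \<bullet> u)\<^sup>2)"
    using bessel_two[OF u n(1), of P] n(2) by (simp add: P_def algebra_simps)
  also have "\<dots> \<le> (norm P)\<^sup>2 * (1 - v\<^sup>2)"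
    using v0 power_mono[of v "- (n \<bullet> u)" 2] by (intro mult_left_mono) auto
  also have "\<dots> = (norm P * (x * sin \<alpha> + y * cos \<alpha>))\<^sup>2"
    by (simp add: sv power_mult_distrib)
  finally have "P \<bullet> u \<le> norm P * (x * sin \<alpha> + y * cos \<alpha>)"
    by (rule power2_le_imp_le)
      (intro mult_nonneg_nonneg add_nonneg_nonneg norm_ge_zero x(1) y(1) a(4) less_imp_le[OF a(3)])
  then have "tan \<alpha> * (P \<bullet> u) \<le> tan \<alpha> * (norm P * (x * sin \<alpha> + y * cos \<alpha>))"
    using a(1) by (intro mult_left_mono) auto
  moreover have "norm P * v \<le> tan \<alpha> * (2 * norm (s - g)) + tan \<alpha> * (P \<bullet> u)"
    using two_points_in_cone_bound(1)[OF al u cone(1,2,1) n x(1,3) sg]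
    by (simp add: v_def y_def P_def distrib_left)
  ultimately have "norm P * (v - tan \<alpha> * (x * sin \<alpha> + y * cos \<alpha>)) \<le> 2 * tan \<alpha> * norm (s - g)"
    by (simp add: right_diff_distrib mult.left_commute)
  moreover have "v - tan \<alpha> * (x * sin \<alpha> + y * cos \<alpha>) = cos \<alpha> * (x * (1 - (tan \<alpha>)\<^sup>2) - 2 * y * tan \<alpha>)"
  proof -
    have sin: "sin \<alpha> = tan \<alpha> * cos \<alpha>" using a(3) by (simp add: tan_def)
    show ?thesis unfolding v_def sin by algebra
  qed
  ultimately show ?thesis by (simp add: P_def y_def)
qed

lemma viewing_angle_estimates:
  fixes T r x :: real
  assumes T: "0 \<le> T" "T \<le> 10051 / 100000" and r: "0 \<le> r"
    and x: "x = 757 / 1000 * r + 2575 / 10000" "x \<le> 1"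
  shows "r * (1 - T) * sqrt (1 + T\<^sup>2) \<le> x * (1 - T\<^sup>2) - 2 * sqrt (1 - x\<^sup>2) * T"
    and "(r * (1 - T)\<^sup>2 + T * sqrt (4 * (1 - T)\<^sup>2 - 1)) * sqrt (1 + T\<^sup>2) \<le> x - sqrt (1 - x\<^sup>2) * T"
proof -
  define s :: real where "s = 100505 / 100000"
  define y where "y = 5 / 4 - 3 / 4 * x"
  define k where "k = 17374 / 10000 - 2406 / 1000 * T"
  define \<rho> where "\<rho> = r / (981 / 1000)"
  have \<rho>: "0 \<le> \<rho>" "\<rho> \<le> 1" "r = 981 / 1000 * \<rho>" using r x by (simp_all add: \<rho>_def)
  have TT: "T * T \<le> 10051 / 100000 * T" using T by (intro mult_right_mono) auto
  have s: "sqrt (1 + T\<^sup>2) \<le> s"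
  proof (rule real_le_lsqrt)
    have "T * T \<le> (10051 / 100000) * (10051 / 100000)" using T by (intro mult_mono) auto
    then show "1 + T\<^sup>2 \<le> s\<^sup>2" by (simp add: s_def power2_eq_square)
  qed (simp add: s_def)
  have y: "sqrt (1 - x\<^sup>2) \<le> y"
  proof (rule real_le_lsqrt)
    have "0 \<le> (3 / 4 - 5 / 4 * x)\<^sup>2" by simp
    then show "1 - x\<^sup>2 \<le> y\<^sup>2" by (simp add: y_def power2_eq_square algebra_simps)
  qed (use x in \<open>simp add: y_def\<close>)
  have k: "sqrt (4 * (1 - T)\<^sup>2 - 1) \<le> k"
  proof (rule real_le_lsqrt)
    have "0 \<le> (T - 1 / 10)\<^sup>2" by simp
    then show "4 * (1 - T)\<^sup>2 - 1 \<le> k\<^sup>2" using T by (simp add: k_def power2_eq_square algebra_simps)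
  qed (use T in \<open>simp add: k_def\<close>)
  have "r * (1 - T) * sqrt (1 + T\<^sup>2) \<le> r * (1 - T) * s"
    using r T s by (intro mult_left_mono) auto
  also have "\<dots> \<le> x * (1 - T\<^sup>2) - 2 * y * T"
  proof -
    have a: "0 \<le> 2575 / 10000 * (1 + 3 / 2 * T - T * T) - 5 / 2 * T"
      using T TT by simp
    have b: "0 \<le> (757 / 1000 * (981 / 1000) + 2575 / 10000) * (1 + 3 / 2 * T - T * T) - 5 / 2 * T
        - 981 / 1000 * s * (1 - T)"
      using T TT by (simp add: s_def)
    have "x * (1 - T\<^sup>2) - 2 * y * T - r * (1 - T) * s
      = (1 - \<rho>) * (2575 / 10000 * (1 + 3 / 2 * T - T * T) - 5 / 2 * T)
      + \<rho> * ((757 / 1000 * (981 / 1000) + 2575 / 10000) * (1 + 3 / 2 * T - T * T) - 5 / 2 * T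
        - 981 / 1000 * s * (1 - T))"
      unfolding x(1) y_def \<rho>(3) by (simp add: power2_eq_square field_simps)
    also have "\<dots> \<ge> 0" using \<rho> a b by (intro add_nonneg_nonneg mult_nonneg_nonneg) auto
    finally show ?thesis by simp
  qed
  also have "\<dots> \<le> x * (1 - T\<^sup>2) - 2 * sqrt (1 - x\<^sup>2) * T"
    using T y by (intro diff_left_mono mult_right_mono) auto
  finally show "r * (1 - T) * sqrt (1 + T\<^sup>2) \<le> x * (1 - T\<^sup>2) - 2 * sqrt (1 - x\<^sup>2) * T" .
  have "(r * (1 - T)\<^sup>2 + T * sqrt (4 * (1 - T)\<^sup>2 - 1)) * sqrt (1 + T\<^sup>2) \<le> (r * (1 - T)\<^sup>2 + T * k) * s"
    using r T s k by (intro mult_mono add_mono mult_left_mono add_nonneg_nonneg mult_nonneg_nonneg)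
      (auto simp: k_def)
  also have "\<dots> \<le> x - y * T"
  proof -
    have "2575 / 10000 * (1 + 3 / 4 * T) - 5 / 4 * T - T * k * s
      = (10051 / 100000 - T) * (280304887 / 100000000 - 24181503 / 10000000 * (T + 10051 / 100000))
      + (2575 / 10000 - 10051 / 100000 * (280304887 / 100000000)
        + 24181503 / 10000000 * (10051 / 100000 * (10051 / 100000)))"
      by (simp add: k_def s_def field_simps)
    also have "\<dots> \<ge> 0" by (rule add_nonneg_nonneg, rule mult_nonneg_nonneg) (use T in simp_all)
    finally have a: "0 \<le> 2575 / 10000 * (1 + 3 / 4 * T) - 5 / 4 * T - T * k * s" .
    have "(757 / 1000 * (981 / 1000) + 2575 / 10000) * (1 + 3 / 4 * T) - 5 / 4 * T - T * k * s
        - 981 / 1000 * s * (1 - T)\<^sup>2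
      = 143219625 / 100000000 * (T - 957 / 10000)\<^sup>2
      + (1416295 / 100000000 - 143219625 / 100000000 * (957 / 10000 * (957 / 10000))
        - (27417802 / 100000000 - 143219625 / 100000000 * (957 / 5000)) * T)"
      by (simp add: k_def s_def power2_eq_square field_simps)
    also have "\<dots> \<ge> 0" by (rule add_nonneg_nonneg, rule mult_nonneg_nonneg) (use T in simp_all)
    finally have b: "0 \<le> (757 / 1000 * (981 / 1000) + 2575 / 10000) * (1 + 3 / 4 * T) - 5 / 4 * T - T * k * s
        - 981 / 1000 * s * (1 - T)\<^sup>2" .
    have "x - y * T - (r * (1 - T)\<^sup>2 + T * k) * s
      = (1 - \<rho>) * (2575 / 10000 * (1 + 3 / 4 * T) - 5 / 4 * T - T * k * s)
      + \<rho> * ((757 / 1000 * (981 / 1000) + 2575 / 10000) * (1 + 3 / 4 * T) - 5 / 4 * T - T * k * s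
        - 981 / 1000 * s * (1 - T)\<^sup>2)"
      unfolding x(1) y_def \<rho>(3) by (simp add: power2_eq_square field_simps)
    also have "\<dots> \<ge> 0" using \<rho> a b by (intro add_nonneg_nonneg mult_nonneg_nonneg) auto
    finally show ?thesis by simp
  qed
  also have "\<dots> \<le> x - sqrt (1 - x\<^sup>2) * T"
    using T y by (intro diff_left_mono mult_right_mono) auto
  finally show "(r * (1 - T)\<^sup>2 + T * sqrt (4 * (1 - T)\<^sup>2 - 1)) * sqrt (1 + T\<^sup>2)
      \<le> x - sqrt (1 - x\<^sup>2) * T" .
qed

text \<open>Here \<open>D\<close> is the position of a camera relative to the target. As \<open>\<alpha>\<close> tends to 0 the condition
  \<open>(norm D)\<^sup>2 \<le> \<beta> * (\<nu> \<bullet> D)\<close> is what is needed; the constants account for the higher order terms up to \<open>\<alpha> = 0.1\<close>.\<close>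

definition resolves :: "real \<Rightarrow> point \<Rightarrow> point \<Rightarrow> bool" where
  "resolves \<beta> \<nu> D \<longleftrightarrow> 757 / 1000 * (norm D)\<^sup>2 / \<beta> + 2575 / 10000 * norm D \<le> \<nu> \<bullet> D"

lemma resolves_bounds:
  fixes s g n :: point
  assumes al: "0 < \<alpha>" "\<alpha> \<le> 0.1" and \<beta>: "\<beta> > 0" and u: "norm u = 1"
    and n: "norm n = 1" "resolves \<beta> n (s - g)" and sg: "s \<noteq> g"
    and g: "g \<in> cone3 \<alpha> s u"
  defines "X \<equiv> 2 * tan \<alpha> * \<beta> / (1 - tan \<alpha>)\<^sup>2"
  shows "p \<in> cone3 \<alpha> s u \<Longrightarrow> n \<bullet> (p - g) = 0 \<Longrightarrow> norm (p - g) \<le> (1 - tan \<alpha>) * X"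
    and "p \<in> cone3 \<alpha> s u \<Longrightarrow> q \<in> cone3 \<alpha> s u \<Longrightarrow> n \<bullet> (p - q) = 0 \<Longrightarrow>
      norm (p - g) \<le> (1 - tan \<alpha>) * X \<Longrightarrow> norm (q - g) \<le> (1 - tan \<alpha>) * X \<Longrightarrow> norm (p - q) \<le> X"
proof -
  note a = tan_le_of_le_tenth[OF al]
  define T where "T = tan \<alpha>"
  have T: "0 < T" "T \<le> 10051 / 100000" using a by (simp_all add: T_def)
  define R where "R = norm (s - g)"
  have R: "R > 0" using sg by (simp add: R_def)
  define r where "r = R / \<beta>"
  have r: "r > 0" "R = r * \<beta>" using R \<beta> by (simp_all add: r_def)
  define x where "x = 757 / 1000 * r + 2575 / 10000"
  have x0: "0 \<le> x" using r by (simp add: x_def)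
  have xR: "x * norm (s - g) \<le> n \<bullet> (s - g)"
    using n(2) \<beta> by (simp add: resolves_def x_def r_def R_def power2_eq_square algebra_simps)
  also have "\<dots> \<le> norm (s - g)" using norm_cauchy_schwarz[of n "s - g"] n(1) by simp
  finally have x1: "x \<le> 1" using R by (simp add: R_def)
  define y where "y = sqrt (1 - x\<^sup>2)"
  have sec: "cos \<alpha> * sqrt (1 + T\<^sup>2) = 1"
  proof -
    have "1 + T\<^sup>2 = (inverse (cos \<alpha>))\<^sup>2" using tan_sec[of \<alpha>] a(3) by (simp add: T_def)
    then show ?thesis using a(3) by (simp add: real_sqrt_abs)
  qed
  note est = viewing_angle_estimates[OF less_imp_le[OF T(1)] T(2) less_imp_le[OF r(1)] x_def x1, folded y_def]
  have sin: "sin \<alpha> = T * cos \<alpha>" using a(3) by (simp add: T_def tan_def)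
  have c1: "r * (1 - T) \<le> cos \<alpha> * (x * (1 - T\<^sup>2) - 2 * y * T)"
  proof -
    have "cos \<alpha> * (r * (1 - T) * sqrt (1 + T\<^sup>2)) \<le> cos \<alpha> * (x * (1 - T\<^sup>2) - 2 * y * T)"
      using a(3) est(1) by (intro mult_left_mono) auto
    moreover have "cos \<alpha> * (r * (1 - T) * sqrt (1 + T\<^sup>2)) = (cos \<alpha> * sqrt (1 + T\<^sup>2)) * (r * (1 - T))" by simp
    ultimately show ?thesis by (simp add: sec)
  qed
  define k where "k = sqrt (4 * (1 - T)\<^sup>2 - 1)"
  have "1 \<le> 2 * (1 - T)" using T by simp
  then have kk: "k\<^sup>2 = 4 * (1 - T)\<^sup>2 - 1" "0 \<le> k"
    using one_le_power[of "2 * (1 - T)" 2] by (simp_all only: k_def power_mult_distrib) simp_all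
  define v where "v = x * cos \<alpha> - y * sin \<alpha>"
  have c2: "r * (1 - T)\<^sup>2 + T * k \<le> v"
  proof -
    have "cos \<alpha> * ((r * (1 - T)\<^sup>2 + T * k) * sqrt (1 + T\<^sup>2)) \<le> cos \<alpha> * (x - y * T)"
      using a(3) est(2) by (intro mult_left_mono) (auto simp: k_def)
    moreover have "cos \<alpha> * ((r * (1 - T)\<^sup>2 + T * k) * sqrt (1 + T\<^sup>2))
        = (cos \<alpha> * sqrt (1 + T\<^sup>2)) * (r * (1 - T)\<^sup>2 + T * k)" by simp
    moreover have "cos \<alpha> * (x - y * T) = v" by (simp add: v_def sin algebra_simps)
    ultimately show ?thesis by (simp add: sec)
  qed
  have v: "v > 0"
  proof -
    have "0 < r * (1 - T)\<^sup>2" "0 \<le> T * k" using r T kk(2) by simp_all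
    then show ?thesis using c2 by linarith
  qed
  have X: "X > 0" "X * (1 - T)\<^sup>2 = 2 * T * \<beta>" using T \<beta> by (simp_all add: X_def flip: T_def)
  {
    assume p: "p \<in> cone3 \<alpha> s u" "n \<bullet> (p - g) = 0"
    have "norm (p - g) * (r * (1 - T)) \<le> norm (p - g) * (cos \<alpha> * (x * (1 - T\<^sup>2) - 2 * y * T))"
      using c1 by (intro mult_left_mono) auto
    also have "\<dots> \<le> 2 * T * R"
      using point_in_cone_bound[OF al u g p(1) n(1) p(2) x0 x1 xR sg] v
      by (simp add: v_def y_def T_def R_def)
    also have "\<dots> = X * (1 - T)\<^sup>2 * r" using X(2) r(2) by simp
    also have "\<dots> = ((1 - T) * X) * (r * (1 - T))" by (simp add: power2_eq_square)
    finally have "norm (p - g) \<le> (1 - T) * X"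
      using r(1) T by (simp add: mult_le_cancel_right)
    then show "norm (p - g) \<le> (1 - tan \<alpha>) * X" by (simp add: T_def)
  }
  {
    assume pq: "p \<in> cone3 \<alpha> s u" "q \<in> cone3 \<alpha> s u" "n \<bullet> (p - q) = 0"
      and P: "norm (p - g) \<le> (1 - tan \<alpha>) * X" and Q: "norm (q - g) \<le> (1 - tan \<alpha>) * X"
    show "norm (p - q) \<le> X"
    proof (rule ccontr)
      assume "\<not> norm (p - q) \<le> X"
      then have w: "X < norm (p - q)" by simp
      define \<sigma> where "\<sigma> = (p - g) + (q - g)"
      have par: "(norm \<sigma>)\<^sup>2 = 2 * (norm (p - g))\<^sup>2 + 2 * (norm (q - g))\<^sup>2 - (norm (p - q))\<^sup>2"
      proof -
        have "(norm (a + b))\<^sup>2 = 2 * (norm a)\<^sup>2 + 2 * (norm b)\<^sup>2 - (norm (a - b))\<^sup>2" for a b :: point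
          by (simp add: power2_norm_eq_inner inner_add_left inner_add_right inner_diff_left inner_diff_right)
        from this[of "p - g" "q - g"] show ?thesis by (simp add: \<sigma>_def)
      qed
      have "(norm (p - g))\<^sup>2 \<le> ((1 - T) * X)\<^sup>2" "(norm (q - g))\<^sup>2 \<le> ((1 - T) * X)\<^sup>2"
        using P Q by (auto intro!: power_mono simp: T_def)
      moreover have "X\<^sup>2 \<le> (norm (p - q))\<^sup>2" using w X(1) by (intro power_mono) auto
      ultimately have "(norm \<sigma>)\<^sup>2 \<le> 4 * ((1 - T) * X)\<^sup>2 - X\<^sup>2" unfolding par by linarith
      also have "\<dots> = (k * X)\<^sup>2" by (simp only: power_mult_distrib kk) algebra
      finally have \<sigma>: "norm \<sigma> \<le> k * X" by (rule power2_le_imp_le) (use kk(2) X(1) in simp)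
      have "X * v < norm (p - q) * v" using w v by simp
      also have "\<dots> \<le> T * (2 * R + \<sigma> \<bullet> u)"
        using two_points_in_cone_bound(1)[OF al u g pq(1,2) n(1) pq(3) x0 xR sg]
        by (simp add: v_def y_def T_def R_def \<sigma>_def)
      also have "\<dots> \<le> T * (2 * R + k * X)"
        using norm_cauchy_schwarz[of \<sigma> u] u \<sigma> T by (intro mult_left_mono add_left_mono) auto
      also have "\<dots> = X * (r * (1 - T)\<^sup>2 + T * k)"
      proof -
        have "X * (r * (1 - T)\<^sup>2) = 2 * T * R" using X(2) r(2) by (simp add: mult.left_commute)
        then show ?thesis by (simp add: algebra_simps)
      qed
      also have "\<dots> \<le> X * v" using c2 X(1) by (intro mult_left_mono) auto
      finally show False by simp
    qed
  }
qed

lemma resolves_between: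
  assumes "resolves \<beta> \<nu> D" "resolves \<beta> \<nu>' D" "D \<noteq> 0" "\<beta> > 0"
    and "norm \<nu> \<le> 1" "norm \<nu>' \<le> 1" and ab: "0 \<le> a" "0 \<le> b" "0 < a + b"
  obtains c where "norm (c *\<^sub>R (a *\<^sub>R \<nu> + b *\<^sub>R \<nu>')) = 1" "resolves \<beta> (c *\<^sub>R (a *\<^sub>R \<nu> + b *\<^sub>R \<nu>')) D"
proof -
  define m where "m = a *\<^sub>R \<nu> + b *\<^sub>R \<nu>'"
  define t where "t = 757 / 1000 * (norm D)\<^sup>2 / \<beta> + 2575 / 10000 * norm D"
  have t: "0 < t" using assms(3,4) unfolding t_def by (intro add_nonneg_pos) auto
  have "(a + b) * t \<le> a * (\<nu> \<bullet> D) + b * (\<nu>' \<bullet> D)"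
    unfolding distrib_right using assms(1,2) ab
    by (intro add_mono mult_left_mono) (auto simp: resolves_def t_def)
  then have mD: "(a + b) * t \<le> m \<bullet> D" by (simp add: m_def inner_add_left)
  have "norm m \<le> a * norm \<nu> + b * norm \<nu>'"
    using norm_triangle_ineq[of "a *\<^sub>R \<nu>" "b *\<^sub>R \<nu>'"] ab by (simp add: m_def)
  also have "\<dots> \<le> a * 1 + b * 1" using assms(5,6) ab by (intro add_mono mult_left_mono) auto
  finally have m: "norm m \<le> a + b" by simp
  have "0 < (a + b) * t" using t ab by simp
  then have m0: "norm m > 0" using mD by auto
  have "norm m * t \<le> (a + b) * t" using m t by (intro mult_right_mono) auto
  then have "t \<le> (1 / norm m) * (m \<bullet> D)" using mD m0 by (simp add: field_simps)
  then show ?thesis using that[of "1 / norm m"] m0 by (simp add: resolves_def t_def flip: m_def)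
qed

lemma resolving_normal:
  assumes "\<beta> > 0" "norm \<nu> \<le> 1" "norm \<nu>' \<le> 1" "D \<noteq> 0" "D' \<noteq> 0"
    and "resolves \<beta> \<nu> D" "resolves \<beta> \<nu>' D" "resolves \<beta> \<nu> D'" "resolves \<beta> (- \<nu>') D'"
  obtains n where "norm n = 1" "n \<bullet> w = 0" "resolves \<beta> n D \<or> resolves \<beta> n D'"
proof -
  have *: thesis if AB: "\<epsilon> \<in> {-1, 1}" "(a *\<^sub>R \<nu> + b *\<^sub>R \<nu>') \<bullet> w = 0" "0 \<le> a" "0 \<le> \<epsilon> * b" "a \<noteq> 0 \<or> b \<noteq> 0" for \<epsilon> a b :: real
  proof -
    have eb: "(\<epsilon> * b) *\<^sub>R (\<epsilon> *\<^sub>R \<nu>') = b *\<^sub>R \<nu>'" using AB(1) by auto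
    have ab: "0 < a + \<epsilon> * b" using AB by (auto simp: less_le)
    have ne: "norm (\<epsilon> *\<^sub>R \<nu>') \<le> 1" using AB(1) assms(3) by auto
    consider "\<epsilon> = 1" | "\<epsilon> = -1" using AB(1) by auto
    then obtain E where E: "resolves \<beta> \<nu> E" "resolves \<beta> (\<epsilon> *\<^sub>R \<nu>') E" "E \<noteq> 0" "E = D \<or> E = D'"
      using assms by cases auto
    obtain c where "norm (c *\<^sub>R (a *\<^sub>R \<nu> + b *\<^sub>R \<nu>')) = 1" "resolves \<beta> (c *\<^sub>R (a *\<^sub>R \<nu> + b *\<^sub>R \<nu>')) E"
      using resolves_between[OF E(1-3) assms(1,2) ne AB(3,4) ab] unfolding eb by blast
    moreover have "(c *\<^sub>R (a *\<^sub>R \<nu> + b *\<^sub>R \<nu>')) \<bullet> w = 0" using AB(2) by simp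
    ultimately show thesis using E(4) \<open>\<And>n. norm n = 1 \<Longrightarrow> n \<bullet> w = 0 \<Longrightarrow> resolves \<beta> n D \<or> resolves \<beta> n D' \<Longrightarrow> thesis\<close>
      by blast
  qed
  define a b where "a = \<nu>' \<bullet> w" and "b = - (\<nu> \<bullet> w)"
  have ab: "(a *\<^sub>R \<nu> + b *\<^sub>R \<nu>') \<bullet> w = 0" "((- a) *\<^sub>R \<nu> + (- b) *\<^sub>R \<nu>') \<bullet> w = 0"
    by (simp_all add: a_def b_def inner_add_left inner_diff_left)
  consider "a = 0 \<and> b = 0" | "a \<ge> 0" "b \<ge> 0" "a \<noteq> 0 \<or> b \<noteq> 0" | "a \<ge> 0" "b \<le> 0" "a \<noteq> 0 \<or> b \<noteq> 0"
    | "a \<le> 0" "b \<ge> 0" "a \<noteq> 0 \<or> b \<noteq> 0" | "a \<le> 0" "b \<le> 0" "a \<noteq> 0 \<or> b \<noteq> 0"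
    by linarith
  then show thesis
  proof cases
    case 1
    then show ?thesis using *[of 1 1 0] by (simp add: b_def)
  next
    case 2
    then show ?thesis using *[of 1 a b] ab by simp
  next
    case 3
    then show ?thesis using *[of "-1" a b] ab by simp
  next
    case 4
    then show ?thesis using *[of "-1" "- a" "- b"] ab by simp
  next
    case 5
    then show ?thesis using *[of 1 "- a" "- b"] ab by simp
  qed
qed

lemma loc_err_pair_le:
  fixes s s' g :: point
  assumes al: "0 < \<alpha>" "\<alpha> \<le> 0.1" and \<beta>: "\<beta> > 0" and \<nu>: "norm \<nu> \<le> 1" "norm \<nu>' \<le> 1"
    and sg: "s \<noteq> g" "s' \<noteq> g"
    and res: "resolves \<beta> \<nu> (s - g)" "resolves \<beta> \<nu>' (s - g)" "resolves \<beta> \<nu> (s' - g)" "resolves \<beta> (- \<nu>') (s' - g)"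
  shows "loc_err \<alpha> g {s, s'} \<le> ereal (2 * tan \<alpha> * \<beta> / (1 - tan \<alpha>)\<^sup>2)"
proof -
  define X where "X = 2 * tan \<alpha> * \<beta> / (1 - tan \<alpha>)\<^sup>2"
  have "dist p q \<le> X"
    if K: "\<forall>t\<in>{s, s'}. K t \<in> cones_containing \<alpha> g t" and pq: "p \<in> K s \<inter> K s'" "q \<in> K s \<inter> K s'" for K p q
  proof -
    obtain u u' where u: "norm u = 1" "K s = cone3 \<alpha> s u" "g \<in> cone3 \<alpha> s u"
      and u': "norm u' = 1" "K s' = cone3 \<alpha> s' u'" "g \<in> cone3 \<alpha> s' u'"
      using K by (auto simp: cones_containing_def)
    have ne: "s - g \<noteq> 0" "s' - g \<noteq> 0" using sg by auto
    have near: "norm (y - g) \<le> (1 - tan \<alpha>) * X" if "y \<in> K s \<inter> K s'" for y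
    proof -
      obtain n where n: "norm n = 1" "n \<bullet> (y - g) = 0" "resolves \<beta> n (s - g) \<or> resolves \<beta> n (s' - g)"
        using resolving_normal[OF \<beta> \<nu> ne res] by metis
      then show ?thesis
        using resolves_bounds(1)[OF al \<beta> u(1) n(1) _ sg(1) u(3)]
          resolves_bounds(1)[OF al \<beta> u'(1) n(1) _ sg(2) u'(3)] that u u'
        unfolding X_def by auto
    qed
    obtain n where n: "norm n = 1" "n \<bullet> (p - q) = 0" "resolves \<beta> n (s - g) \<or> resolves \<beta> n (s' - g)"
      using resolving_normal[OF \<beta> \<nu> ne res] by metis
    then show ?thesis
      using resolves_bounds(2)[OF al \<beta> u(1) n(1) _ sg(1) u(3)]
        resolves_bounds(2)[OF al \<beta> u'(1) n(1) _ sg(2) u'(3)] near[OF pq(1)] near[OF pq(2)] pq u u'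
      unfolding X_def dist_norm by auto
  qed
  then show ?thesis unfolding loc_err_def ediam_def X_def[symmetric]
    by (intro SUP_least) auto
qed

lemma resolves_mono:
  assumes "resolves \<beta> \<nu> D" "0 < \<beta>" "\<beta> \<le> \<beta>'"
  shows "resolves \<beta>' \<nu> D"
proof -
  have "757 / 1000 * (norm D)\<^sup>2 / \<beta>' \<le> 757 / 1000 * (norm D)\<^sup>2 / \<beta>"
    using assms by (intro divide_left_mono) auto
  then show ?thesis using assms(1) by (simp add: resolves_def)
qed

lemma resolves_convex:
  assumes "resolves \<beta>\<^sub>0 \<nu> D\<^sub>0" "resolves \<beta>\<^sub>1 \<nu> D\<^sub>1" "0 < \<beta>\<^sub>0" "0 < \<beta>\<^sub>1" "0 \<le> t" "t \<le> 1"
  shows "resolves ((1 - t) * \<beta>\<^sub>0 + t * \<beta>\<^sub>1) \<nu> ((1 - t) *\<^sub>R D\<^sub>0 + t *\<^sub>R D\<^sub>1)"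
proof -
  define a where "a = 1 - t"
  have a: "0 \<le> a" "a + t = 1" using assms by (simp_all add: a_def)
  define D \<beta> where "D = a *\<^sub>R D\<^sub>0 + t *\<^sub>R D\<^sub>1" and "\<beta> = a * \<beta>\<^sub>0 + t * \<beta>\<^sub>1"
  have \<beta>: "0 < \<beta>"
    using assms a by (cases "t = 0") (auto simp: \<beta>_def intro: add_nonneg_pos)
  have n: "norm D \<le> a * norm D\<^sub>0 + t * norm D\<^sub>1"
    using norm_triangle_ineq[of "a *\<^sub>R D\<^sub>0" "t *\<^sub>R D\<^sub>1"] a assms by (simp add: D_def)
  have "(norm D)\<^sup>2 \<le> (a * norm D\<^sub>0 + t * norm D\<^sub>1)\<^sup>2" using n by (intro power_mono) auto
  also have "\<dots> \<le> (a * ((norm D\<^sub>0)\<^sup>2 / \<beta>\<^sub>0) + t * ((norm D\<^sub>1)\<^sup>2 / \<beta>\<^sub>1)) * \<beta>"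
  proof -
    have "(a * ((norm D\<^sub>0)\<^sup>2 / \<beta>\<^sub>0) + t * ((norm D\<^sub>1)\<^sup>2 / \<beta>\<^sub>1)) * \<beta> - (a * norm D\<^sub>0 + t * norm D\<^sub>1)\<^sup>2
      = a * t * (norm D\<^sub>0 * \<beta>\<^sub>1 - norm D\<^sub>1 * \<beta>\<^sub>0)\<^sup>2 / (\<beta>\<^sub>0 * \<beta>\<^sub>1)"
      using assms(3,4) by (simp add: \<beta>_def power2_eq_square field_simps)
    also have "\<dots> \<ge> 0" using assms a by simp
    finally show ?thesis by simp
  qed
  finally have q: "(norm D)\<^sup>2 / \<beta> \<le> a * ((norm D\<^sub>0)\<^sup>2 / \<beta>\<^sub>0) + t * ((norm D\<^sub>1)\<^sup>2 / \<beta>\<^sub>1)"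
    using \<beta> by (simp add: pos_divide_le_eq)
  have "757 / 1000 * ((norm D)\<^sup>2 / \<beta>) + 2575 / 10000 * norm D
      \<le> 757 / 1000 * (a * ((norm D\<^sub>0)\<^sup>2 / \<beta>\<^sub>0) + t * ((norm D\<^sub>1)\<^sup>2 / \<beta>\<^sub>1))
        + 2575 / 10000 * (a * norm D\<^sub>0 + t * norm D\<^sub>1)"
    using q n by (intro add_mono mult_left_mono) auto
  also have "\<dots> = a * (757 / 1000 * (norm D\<^sub>0)\<^sup>2 / \<beta>\<^sub>0 + 2575 / 10000 * norm D\<^sub>0)
      + t * (757 / 1000 * (norm D\<^sub>1)\<^sup>2 / \<beta>\<^sub>1 + 2575 / 10000 * norm D\<^sub>1)"
    by (simp add: distrib_left)
  also have "\<dots> \<le> a * (\<nu> \<bullet> D\<^sub>0) + t * (\<nu> \<bullet> D\<^sub>1)"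
    using assms a by (intro add_mono mult_left_mono) (auto simp: resolves_def)
  also have "\<dots> = \<nu> \<bullet> D" by (simp add: D_def inner_add_right)
  finally have "757 / 1000 * ((norm D)\<^sup>2 / \<beta>) + 2575 / 10000 * norm D \<le> \<nu> \<bullet> D" .
  then show ?thesis by (simp add: resolves_def D_def \<beta>_def flip: a_def)
qed

lemma convex_coefficient:
  fixes x x\<^sub>0 x\<^sub>1 :: real
  assumes "x\<^sub>0 \<le> x" "x \<le> x\<^sub>1"
  obtains t where "0 \<le> t" "t \<le> 1" "x = (1 - t) * x\<^sub>0 + t * x\<^sub>1"
proof (cases "x\<^sub>0 = x\<^sub>1")
  case True
  then show ?thesis using that[of 0] assms by simp
next
  case False
  define t where "t = (x - x\<^sub>0) / (x\<^sub>1 - x\<^sub>0)"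
  have "t * (x\<^sub>1 - x\<^sub>0) = x - x\<^sub>0" using False by (simp add: t_def)
  then have "x = (1 - t) * x\<^sub>0 + t * x\<^sub>1" by (simp add: algebra_simps)
  moreover have "0 \<le> t" "t \<le> 1" using assms False by (simp_all add: t_def)
  ultimately show ?thesis using that by blast
qed

lemma vector_convex_combination:
  "(1 - t) *\<^sub>R vector [x, y, z] + t *\<^sub>R vector [x', y', z']
    = (vector [(1 - t) * x + t * x', (1 - t) * y + t * y', (1 - t) * z + t * z'] :: point)"
  by (simp add: vec_eq_iff forall_3 vector_3)

lemma resolves_segment:
  assumes "resolves \<beta>\<^sub>0 \<nu> (vector [x\<^sub>0, y\<^sub>0, z\<^sub>0])" "resolves \<beta>\<^sub>1 \<nu> (vector [x\<^sub>1, y\<^sub>1, z\<^sub>1])"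
    and "0 < \<beta>\<^sub>0" "0 < \<beta>\<^sub>1" "0 \<le> t" "t \<le> 1"
    and "\<beta> = (1 - t) * \<beta>\<^sub>0 + t * \<beta>\<^sub>1" "x = (1 - t) * x\<^sub>0 + t * x\<^sub>1" "y = (1 - t) * y\<^sub>0 + t * y\<^sub>1"
    "z = (1 - t) * z\<^sub>0 + t * z\<^sub>1"
  shows "resolves \<beta> \<nu> (vector [x, y, z])"
  using resolves_convex[OF assms(1-6)] unfolding assms(7-10) vector_convex_combination .

lemma resolves_box:
  assumes b: "0 < b" and Z: "0 < Z\<^sub>0" "Z\<^sub>0 \<le> Z" "Z \<le> Z\<^sub>1" "2 - Z \<le> z" "z \<le> Z"
    and x: "x\<^sub>0 \<le> x" "x \<le> x\<^sub>1" and y: "y\<^sub>0 \<le> y" "y \<le> y\<^sub>1"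
    and corner: "\<And>Z x y z. Z \<in> {Z\<^sub>0, Z\<^sub>1} \<Longrightarrow> x \<in> {x\<^sub>0, x\<^sub>1} \<Longrightarrow> y \<in> {y\<^sub>0, y\<^sub>1} \<Longrightarrow> z \<in> {2 - Z, Z} \<Longrightarrow>
      resolves (b * Z) \<nu> (vector [x, y, z])"
  shows "resolves (b * Z) \<nu> (vector [x, y, z])"
proof -
  obtain tx where tx: "0 \<le> tx" "tx \<le> 1" "x = (1 - tx) * x\<^sub>0 + tx * x\<^sub>1" using convex_coefficient[OF x] .
  obtain ty where ty: "0 \<le> ty" "ty \<le> 1" "y = (1 - ty) * y\<^sub>0 + ty * y\<^sub>1" using convex_coefficient[OF y] .
  obtain tz where tz: "0 \<le> tz" "tz \<le> 1" "z = (1 - tz) * (2 - Z) + tz * Z" using convex_coefficient[OF Z(4,5)] .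
  obtain tZ where tZ: "0 \<le> tZ" "tZ \<le> 1" "Z = (1 - tZ) * Z\<^sub>0 + tZ * Z\<^sub>1" using convex_coefficient[OF Z(2,3)] .
  have end_height: "resolves (b * W) \<nu> (vector [x, y, (1 - tz) * (2 - W) + tz * W])" if W: "W \<in> {Z\<^sub>0, Z\<^sub>1}" for W
  proof -
    have bW: "0 < b * W" using W b Z by auto
    have eq: "c = (1 - t) * c + t * c" for c t :: real by (simp add: algebra_simps)
    have 1: "resolves (b * W) \<nu> (vector [x, y', z'])" if "y' \<in> {y\<^sub>0, y\<^sub>1}" "z' \<in> {2 - W, W}" for y' z'
      by (rule resolves_segment[OF corner[OF W, of x\<^sub>0 y' z'] corner[OF W, of x\<^sub>1 y' z'] bW bW tx(1,2)])
        (use that tx(3) eq in auto)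
    have 2: "resolves (b * W) \<nu> (vector [x, y, z'])" if "z' \<in> {2 - W, W}" for z'
      by (rule resolves_segment[OF 1[of y\<^sub>0 z'] 1[of y\<^sub>1 z'] bW bW ty(1,2)]) (use that ty(3) eq in auto)
    show ?thesis
      by (rule resolves_segment[OF 2[of "2 - W"] 2[of W] bW bW tz(1,2)]) (use eq in auto)
  qed
  show ?thesis
  proof (rule resolves_segment[OF end_height[of Z\<^sub>0] end_height[of Z\<^sub>1] _ _ tZ(1,2)])
    show "0 < b * Z\<^sub>0" "0 < b * Z\<^sub>1" using b Z by auto
    show "b * Z = (1 - tZ) * (b * Z\<^sub>0) + tZ * (b * Z\<^sub>1)" unfolding tZ(3) by algebra
    show "z = (1 - tZ) * ((1 - tz) * (2 - Z\<^sub>0) + tz * Z\<^sub>0) + tZ * ((1 - tz) * (2 - Z\<^sub>1) + tz * Z\<^sub>1)"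
      unfolding tz(3) tZ(3) by algebra
  qed (simp_all add: algebra_simps)
qed

section \<open>Choice of the camera pair\<close>

text \<open>Lengths (as multiples of \<open>h\<close>) and the bound \<open>l\<close> on the horizontal perturbation are in units of 1/80, the
  entries of \<open>\<nu>\<close> in units of 1/1000. In the notation of \<open>corner_ok\<close>, the condition \<open>resolves\<close> with
  \<open>\<beta> = 4.94 (\<zeta> / 80) / (1 - l / 80)\<close>, multiplied by \<open>80000 \<cdot> 1976 \<zeta>\<close>, reads
  \<open>3785 (80 - l) Q + 508820 \<zeta> sqrt Q \<le> 1976 \<zeta> (a X + b Y + c W)\<close> with \<open>Q = X\<^sup>2 + Y\<^sup>2 + W\<^sup>2\<close>. The nested definitions
  make rewriting evaluate \<open>Q\<close> and the difference \<open>N\<close> only once.\<close>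

definition margin_ok :: "int \<Rightarrow> int \<Rightarrow> int \<Rightarrow> bool" where
  "margin_ok k N Q \<longleftrightarrow> 0 \<le> N \<and> k * k * Q \<le> N * N"

definition excess_ok :: "int \<Rightarrow> int \<Rightarrow> int \<Rightarrow> int \<Rightarrow> bool" where
  "excess_ok k P c Q = margin_ok k (P - c * Q) Q"

fun corner_ok :: "int \<Rightarrow> int \<Rightarrow> int \<times> int \<times> int \<Rightarrow> int \<Rightarrow> int \<Rightarrow> int \<Rightarrow> bool" where
  "corner_ok l \<zeta> (a, b, c) X Y W \<longleftrightarrow>
     excess_ok (508820 * \<zeta>) (1976 * \<zeta> * (a * X + b * Y + c * W)) (3785 * (80 - l)) (X * X + Y * Y + W * W)"

fun face_ok :: "int \<Rightarrow> int \<Rightarrow> int \<Rightarrow> int \<times> int \<Rightarrow> int \<times> int \<times> int \<Rightarrow> bool" where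
  "face_ok l \<zeta> X (Y\<^sub>0, Y\<^sub>1) V \<longleftrightarrow>
     corner_ok l \<zeta> V X Y\<^sub>0 (160 - \<zeta>) \<and> corner_ok l \<zeta> V X Y\<^sub>0 \<zeta> \<and>
     corner_ok l \<zeta> V X Y\<^sub>1 (160 - \<zeta>) \<and> corner_ok l \<zeta> V X Y\<^sub>1 \<zeta>"

fun box_ok :: "int \<Rightarrow> int \<times> int \<Rightarrow> int \<times> int \<Rightarrow> int \<times> int \<Rightarrow> int \<times> int \<times> int \<Rightarrow> bool" where
  "box_ok l (\<zeta>\<^sub>0, \<zeta>\<^sub>1) (X\<^sub>0, X\<^sub>1) Y V \<longleftrightarrow>
     face_ok l \<zeta>\<^sub>0 X\<^sub>0 Y V \<and> face_ok l \<zeta>\<^sub>0 X\<^sub>1 Y V \<and> face_ok l \<zeta>\<^sub>1 X\<^sub>0 Y V \<and> face_ok l \<zeta>\<^sub>1 X\<^sub>1 Y V"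

definition direction :: "int \<times> int \<times> int \<Rightarrow> point" where
  "direction = (\<lambda>(a, b, c). vector [of_int a / 1000, of_int b / 1000, of_int c / 1000])"

lemma corner_ok_resolves:
  assumes "corner_ok l \<zeta> V X Y W" "0 < \<zeta>" "l < 80"
  shows "resolves (494 / 100 / (1 - of_int l / 80) * (of_int \<zeta> / 80)) (direction V)
           (vector [of_int X / 80, of_int Y / 80, of_int W / 80])"
proof -
  obtain a b c where V: "V = (a, b, c)" by (cases V)
  define Q where "Q = X * X + Y * Y + W * W"
  define P where "P = a * X + b * Y + c * W"
  define N where "N = 1976 * \<zeta> * P - 3785 * (80 - l) * Q"
  have N: "0 \<le> N" "(508820 * \<zeta>) * (508820 * \<zeta>) * Q \<le> N * N"
    using assms(1) by (simp_all add: excess_ok_def margin_ok_def V Q_def P_def N_def)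
  have Q0: "0 \<le> Q" by (simp add: Q_def)
  define q where "q = sqrt (of_int Q)"
  have q: "0 \<le> q" "q\<^sup>2 = of_int Q" using Q0 by (simp_all add: q_def)
  have "((508820 * of_int \<zeta>) * q)\<^sup>2 = real_of_int ((508820 * \<zeta>) * (508820 * \<zeta>) * Q)"
    by (simp add: power_mult_distrib q power2_eq_square[of "real_of_int \<zeta>"])
  also have "\<dots> \<le> real_of_int (N * N)" using N(2) by (simp only: of_int_le_iff)
  also have "\<dots> = (real_of_int N)\<^sup>2" by (simp add: power2_eq_square)
  finally have "(508820 * of_int \<zeta>) * q \<le> real_of_int N"
    by (rule power2_le_imp_le) (use N(1) in simp)
  then have main: "508820 * of_int \<zeta> * q + 3785 * (80 - of_int l) * of_int Q \<le> 1976 * of_int \<zeta> * real_of_int P"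
    by (simp add: N_def)
  have nD: "norm (vector [of_int X / 80, of_int Y / 80, of_int W / 80] :: point) = q / 80"
  proof -
    have "(of_int X / 80)\<^sup>2 + (of_int Y / 80)\<^sup>2 + (of_int W / 80)\<^sup>2 = real_of_int Q / 6400"
      by (simp add: Q_def power2_eq_square)
    moreover have "sqrt 6400 = 80" by (rule real_sqrt_unique) simp_all
    ultimately show ?thesis by (simp only: norm_point vector_3 q_def real_sqrt_divide)
  qed
  have inn: "direction V \<bullet> vector [of_int X / 80, of_int Y / 80, of_int W / 80] = of_int P / 80000"
    by (simp add: direction_def V inner_vec_def sum_3 vector_3 P_def)
  have z: "0 < real_of_int \<zeta>" "0 < 80 - real_of_int l" using assms by simp_all
  show ?thesis unfolding resolves_def nD inn power_divide q(2)
    using main z by (simp add: field_simps)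
qed

text \<open>A leaf holds the grid offsets of the two cameras and the directions \<open>\<nu>\<close> and \<open>\<nu>'\<close>; the other nodes subdivide the
  range of the horizontal perturbation bound, of \<open>1 + lam_v\<close>, or of a coordinate of a grid point next to the target.\<close>

datatype plan =
    Leaf "int \<times> int" "int \<times> int" "int \<times> int \<times> int" "int \<times> int \<times> int"
  | Split_shift int plan plan
  | Split_height int plan plan
  | Split_x int plan plan
  | Split_y int plan plan

fun widen :: "int \<Rightarrow> int \<Rightarrow> int \<times> int \<Rightarrow> int \<times> int" where
  "widen l m (x\<^sub>0, x\<^sub>1) = (x\<^sub>0 + 80 * m - l, x\<^sub>1 + 80 * m + l)"

fun unit_ok :: "int \<times> int \<times> int \<Rightarrow> bool" where
  "unit_ok (a, b, c) \<longleftrightarrow> a * a + b * b + c * c \<le> 1000000"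

fun opposite :: "int \<times> int \<times> int \<Rightarrow> int \<times> int \<times> int" where
  "opposite (a, b, c) = (- a, - b, - c)"

fun valid :: "plan \<Rightarrow> int \<times> int \<Rightarrow> int \<times> int \<Rightarrow> int \<times> int \<Rightarrow> int \<times> int \<Rightarrow> bool" where
  "valid (Leaf (m, n) (m', n') V V') (l\<^sub>0, l\<^sub>1) (\<zeta>\<^sub>0, \<zeta>\<^sub>1) X Y \<longleftrightarrow>
     l\<^sub>0 < 80 \<and> 0 < \<zeta>\<^sub>0 \<and> 0 < \<zeta>\<^sub>1 \<and> unit_ok V \<and> unit_ok V' \<and>
     box_ok l\<^sub>0 (\<zeta>\<^sub>0, \<zeta>\<^sub>1) (widen l\<^sub>1 m X) (widen l\<^sub>1 n Y) V \<and>
     box_ok l\<^sub>0 (\<zeta>\<^sub>0, \<zeta>\<^sub>1) (widen l\<^sub>1 m X) (widen l\<^sub>1 n Y) V' \<and>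
     box_ok l\<^sub>0 (\<zeta>\<^sub>0, \<zeta>\<^sub>1) (widen l\<^sub>1 m' X) (widen l\<^sub>1 n' Y) V \<and>
     box_ok l\<^sub>0 (\<zeta>\<^sub>0, \<zeta>\<^sub>1) (widen l\<^sub>1 m' X) (widen l\<^sub>1 n' Y) (opposite V')"
| "valid (Split_shift k p q) (l\<^sub>0, l\<^sub>1) H X Y \<longleftrightarrow> valid p (l\<^sub>0, k) H X Y \<and> valid q (k, l\<^sub>1) H X Y"
| "valid (Split_height k p q) L (\<zeta>\<^sub>0, \<zeta>\<^sub>1) X Y \<longleftrightarrow> valid p L (\<zeta>\<^sub>0, k) X Y \<and> valid q L (k, \<zeta>\<^sub>1) X Y"
| "valid (Split_x k p q) L H (x\<^sub>0, x\<^sub>1) Y \<longleftrightarrow> valid p L H (x\<^sub>0, k) Y \<and> valid q L H (k, x\<^sub>1) Y"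
| "valid (Split_y k p q) L H X (y\<^sub>0, y\<^sub>1) \<longleftrightarrow> valid p L H X (y\<^sub>0, k) \<and> valid q L H X (k, y\<^sub>1)"

definition safe :: "real \<Rightarrow> real \<Rightarrow> point \<Rightarrow> real \<Rightarrow> real \<Rightarrow> bool" where
  "safe \<mu> Z \<nu> x y \<longleftrightarrow> (\<forall>\<xi> \<eta> z. \<bar>\<xi> - x\<bar> \<le> \<mu> \<longrightarrow> \<bar>\<eta> - y\<bar> \<le> \<mu> \<longrightarrow> 2 - Z \<le> z \<longrightarrow> z \<le> Z \<longrightarrow>
     resolves (494 / 100 * Z / (1 - \<mu>)) \<nu> (vector [\<xi>, \<eta>, z]))"

definition in_range :: "real \<Rightarrow> int \<times> int \<Rightarrow> bool" where
  "in_range t = (\<lambda>(k\<^sub>0, k\<^sub>1). of_int k\<^sub>0 / 80 \<le> t \<and> t \<le> of_int k\<^sub>1 / 80)"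

lemma in_range_split:
  assumes "in_range t (k\<^sub>0, k\<^sub>1)"
  shows "in_range t (k\<^sub>0, k) \<or> in_range t (k, k\<^sub>1)"
  using assms by (auto simp: in_range_def)

lemma box_ok_safe:
  assumes ok: "box_ok l\<^sub>0 (\<zeta>\<^sub>0, \<zeta>\<^sub>1) (widen l\<^sub>1 m X) (widen l\<^sub>1 n Y) V" and pos: "l\<^sub>0 < 80" "0 < \<zeta>\<^sub>0" "0 < \<zeta>\<^sub>1"
    and r: "in_range \<mu> (l\<^sub>0, l\<^sub>1)" "\<mu> < 1" "in_range Z (\<zeta>\<^sub>0, \<zeta>\<^sub>1)" "in_range x X" "in_range y Y"
  shows "safe \<mu> Z (direction V) (x + of_int m) (y + of_int n)"
  unfolding safe_def
proof (intro allI impI)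
  fix \<xi> \<eta> z assume *: "\<bar>\<xi> - (x + of_int m)\<bar> \<le> \<mu>" "\<bar>\<eta> - (y + of_int n)\<bar> \<le> \<mu>" "2 - Z \<le> z" "z \<le> Z"
  obtain x\<^sub>0 x\<^sub>1 y\<^sub>0 y\<^sub>1 where XY: "X = (x\<^sub>0, x\<^sub>1)" "Y = (y\<^sub>0, y\<^sub>1)" by (cases X, cases Y)
  define b where "b = 494 / 100 / (1 - real_of_int l\<^sub>0 / 80)"
  have l: "real_of_int l\<^sub>0 / 80 \<le> \<mu>" "\<mu> \<le> real_of_int l\<^sub>1 / 80" using r(1) by (simp_all add: in_range_def)
  have b: "0 < b" using pos by (simp add: b_def)
  have Z: "0 < real_of_int \<zeta>\<^sub>0 / 80" "of_int \<zeta>\<^sub>0 / 80 \<le> Z" "Z \<le> of_int \<zeta>\<^sub>1 / 80"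
    using pos r(3) by (simp_all add: in_range_def)
  have "resolves (b * Z) (direction V) (vector [\<xi>, \<eta>, z])"
  proof (rule resolves_box[OF b Z *(3,4)])
    show "of_int (x\<^sub>0 + 80 * m - l\<^sub>1) / 80 \<le> \<xi>" "\<xi> \<le> of_int (x\<^sub>1 + 80 * m + l\<^sub>1) / 80"
      "of_int (y\<^sub>0 + 80 * n - l\<^sub>1) / 80 \<le> \<eta>" "\<eta> \<le> of_int (y\<^sub>1 + 80 * n + l\<^sub>1) / 80"
      using * l r(4,5) by (simp_all add: in_range_def XY abs_le_iff add_divide_distrib diff_divide_distrib)
    fix Z' x' y' z' :: real
    assume "Z' \<in> {of_int \<zeta>\<^sub>0 / 80, of_int \<zeta>\<^sub>1 / 80}"
      and "x' \<in> {of_int (x\<^sub>0 + 80 * m - l\<^sub>1) / 80, of_int (x\<^sub>1 + 80 * m + l\<^sub>1) / 80}"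
      and "y' \<in> {of_int (y\<^sub>0 + 80 * n - l\<^sub>1) / 80, of_int (y\<^sub>1 + 80 * n + l\<^sub>1) / 80}"
      and z': "z' \<in> {2 - Z', Z'}"
    then obtain \<zeta> A B where A: "Z' = of_int \<zeta> / 80" "x' = of_int A / 80" "y' = of_int B / 80"
      "\<zeta> \<in> {\<zeta>\<^sub>0, \<zeta>\<^sub>1}" "A \<in> {x\<^sub>0 + 80 * m - l\<^sub>1, x\<^sub>1 + 80 * m + l\<^sub>1}" "B \<in> {y\<^sub>0 + 80 * n - l\<^sub>1, y\<^sub>1 + 80 * n + l\<^sub>1}"
      by blast
    moreover have "z' = of_int (160 - \<zeta>) / 80 \<or> z' = of_int \<zeta> / 80"
      using z' A(1) by (auto simp: diff_divide_distrib)
    then obtain W where W: "z' = of_int W / 80" "W \<in> {160 - \<zeta>, \<zeta>}" by blast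
    ultimately have "corner_ok l\<^sub>0 \<zeta> V A B W"
      using ok unfolding XY by (auto simp del: corner_ok.simps)
    moreover have "0 < \<zeta>" using A(4) pos by auto
    ultimately show "resolves (b * Z') (direction V) (vector [x', y', z'])"
      unfolding A(1-3) W(1) b_def by (intro corner_ok_resolves pos(1))
  qed
  moreover have "b * Z \<le> 494 / 100 * Z / (1 - \<mu>)"
  proof -
    have "494 / 100 * Z / (1 - real_of_int l\<^sub>0 / 80) \<le> 494 / 100 * Z / (1 - \<mu>)"
      using Z r(2) l pos by (intro divide_left_mono) auto
    then show ?thesis by (simp add: b_def)
  qed
  moreover have "0 < b * Z" using b Z by simp
  ultimately show "resolves (494 / 100 * Z / (1 - \<mu>)) (direction V) (vector [\<xi>, \<eta>, z])"
    using resolves_mono by blast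
qed

lemma norm_direction_le: "unit_ok V \<Longrightarrow> norm (direction V) \<le> 1"
proof (cases V)
  case (fields a b c)
  assume "unit_ok V"
  then have "real_of_int (a * a + b * b + c * c) \<le> real_of_int 1000000"
    unfolding fields by (simp only: unit_ok.simps of_int_le_iff)
  then show ?thesis by (simp add: fields direction_def norm_point vector_3 power2_eq_square)
qed

lemma direction_opposite: "direction (opposite V) = - direction V"
  by (cases V) (simp add: direction_def vec_eq_iff forall_3 vector_3)

lemma valid_sound:
  assumes "valid p L H X Y" "in_range \<mu> L" "\<mu> < 1" "in_range Z H" "in_range x X" "in_range y Y"
  shows "\<exists>m n m' n' \<nu> \<nu>'. norm \<nu> \<le> 1 \<and> norm \<nu>' \<le> 1 \<and>
    safe \<mu> Z \<nu> (x + of_int m) (y + of_int n) \<and> safe \<mu> Z \<nu>' (x + of_int m) (y + of_int n) \<and>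
    safe \<mu> Z \<nu> (x + of_int m') (y + of_int n') \<and> safe \<mu> Z (- \<nu>') (x + of_int m') (y + of_int n')"
  using assms
proof (induction p L H X Y rule: valid.induct)
  case (1 m n m' n' V V' l\<^sub>0 l\<^sub>1 \<zeta>\<^sub>0 \<zeta>\<^sub>1 X Y)
  then have v: "l\<^sub>0 < 80" "0 < \<zeta>\<^sub>0" "0 < \<zeta>\<^sub>1" and u: "unit_ok V" "unit_ok V'"
    and ok: "box_ok l\<^sub>0 (\<zeta>\<^sub>0, \<zeta>\<^sub>1) (widen l\<^sub>1 m X) (widen l\<^sub>1 n Y) V"
     "box_ok l\<^sub>0 (\<zeta>\<^sub>0, \<zeta>\<^sub>1) (widen l\<^sub>1 m X) (widen l\<^sub>1 n Y) V'"
     "box_ok l\<^sub>0 (\<zeta>\<^sub>0, \<zeta>\<^sub>1) (widen l\<^sub>1 m' X) (widen l\<^sub>1 n' Y) V"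
     "box_ok l\<^sub>0 (\<zeta>\<^sub>0, \<zeta>\<^sub>1) (widen l\<^sub>1 m' X) (widen l\<^sub>1 n' Y) (opposite V')"
    by (simp_all del: unit_ok.simps box_ok.simps)
  show ?case
    by (intro exI[of _ m] exI[of _ n] exI[of _ m'] exI[of _ n'] exI[of _ "direction V"] exI[of _ "direction V'"] conjI
        norm_direction_le u ok(1-3)[THEN box_ok_safe[OF _ v 1(2-6)]]
        ok(4)[THEN box_ok_safe[OF _ v 1(2-6)], unfolded direction_opposite])
next
  case (2 k p q l\<^sub>0 l\<^sub>1 H X Y)
  then show ?case using in_range_split[of \<mu> l\<^sub>0 l\<^sub>1 k] by auto
next
  case (3 k p q L \<zeta>\<^sub>0 \<zeta>\<^sub>1 X Y)
  then show ?case using in_range_split[of Z \<zeta>\<^sub>0 \<zeta>\<^sub>1 k] by auto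
next
  case (4 k p q L H x\<^sub>0 x\<^sub>1 Y)
  then show ?case using in_range_split[of x x\<^sub>0 x\<^sub>1 k] by auto
next
  case (5 k p q L H X y\<^sub>0 y\<^sub>1)
  then show ?case using in_range_split[of y y\<^sub>0 y\<^sub>1 k] by auto
qed

text \<open>The entries were found by numerical optimisation.\<close>

definition plan_corner :: plan where
  "plan_corner =
    (Split_shift 12
     (Split_height 140
      (Split_shift 8
       (Leaf (1, 1) (-2, 1) (-155, 829, 535) (994, 60, 88))
       (Leaf (1, 1) (-2, 1) (-131, 821, 555) (993, 71, 88)))
      (Leaf (0, -3) (-3, 0) (-684, -684, 251) (707, -707, 0)))
     (Split_shift 26
      (Split_height 90
       (Split_shift 22
        (Leaf (0, 1) (-1, -1) (-327, 168, 929) (349, 936, 27))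
        (Split_shift 24
         (Leaf (-1, 2) (-1, -1) (-428, 202, 880) (181, 973, -138))
         (Leaf (2, -1) (-1, -1) (196, -409, 891) (973, 185, -138))))
       (Split_height 120
        (Split_shift 18
         (Leaf (1, 1) (-2, 1) (-115, 756, 644) (992, 93, 75))
         (Split_shift 22
          (Leaf (0, -3) (-2, 0) (-582, -647, 492) (614, -773, -158))
          (Leaf (0, -3) (-2, 0) (-585, -633, 507) (587, -778, -218))))
        (Leaf (0, -3) (-3, 0) (-684, -684, 252) (707, -707, 0))))
      (Split_shift 31
       (Split_height 90
        (Split_shift 28
         (Leaf (-1, 2) (-1, -1) (-392, 190, 900) (186, 972, -143))
         (Split_shift 29
          (Leaf (0, -3) (-2, 0) (-564, -625, 539) (596, -772, -220))
          (Split_shift 30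
           (Leaf (0, -3) (-2, 0) (-563, -622, 543) (596, -770, -226))
           (Leaf (0, -3) (-2, 0) (-566, -622, 541) (596, -768, -233)))))
        (Leaf (0, -3) (-3, 0) (-644, -644, 412) (707, -707, 0)))
       (Split_shift 32
        (Leaf (0, -3) (-3, 0) (-628, -628, 458) (707, -707, 0))
        (Split_shift 34
         (Leaf (0, -3) (-3, 0) (-628, -628, 458) (707, -707, 0))
         (Split_shift 36
          (Leaf (0, -3) (-3, 0) (-628, -628, 457) (707, -707, 0))
          (Split_shift 40
           (Leaf (0, -3) (-3, 0) (-629, -629, 456) (707, -707, 0))
           (Split_shift 44
            (Leaf (0, -3) (-3, 0) (-659, -659, 359) (707, -707, 0))
            (Leaf (0, -4) (-3, 0) (-665, -682, 303) (652, -740, -165))))))))))"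

definition plan_edge_x :: plan where
  "plan_edge_x =
    (Split_shift 12
     (Split_height 100
      (Leaf (1, 0) (-1, -1) (280, -366, 886) (927, 357, -109))
      (Leaf (2, -1) (0, 2) (779, 436, 450) (558, -825, -82)))
     (Split_shift 20
      (Split_height 90
       (Leaf (0, -2) (-2, 0) (-468, -559, 684) (711, -696, -94))
       (Leaf (2, -1) (0, 2) (766, 439, 469) (551, -829, -89)))
      (Split_shift 28
       (Split_height 100
        (Leaf (1, 0) (-1, -2) (410, -577, 706) (766, 627, 140))
        (Leaf (2, 0) (-1, 3) (548, 742, 385) (724, -674, 143)))
       (Split_shift 40
        (Split_height 120
         (Split_shift 32
          (Leaf (0, 2) (-3, 0) (-549, 633, 544) (782, 622, 18))
          (Split_shift 36
           (Leaf (0, 2) (-3, 0) (-531, 634, 561) (796, 602, 58))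
           (Leaf (2, 0) (-1, 3) (520, 699, 490) (738, -654, 164))))
         (Leaf (0, 3) (-4, 0) (-630, 723, 282) (767, 641, 24)))
        (Split_shift 44
         (Leaf (0, 3) (-4, 0) (-616, 678, 400) (762, 646, 21))
         (Leaf (0, 3) (-4, 0) (-621, 700, 352) (753, 657, -16)))))))"

definition plan_edge_y :: plan where
  "plan_edge_y =
    (Split_shift 12
     (Split_height 100
      (Leaf (0, 1) (-1, -1) (-366, 280, 886) (357, 927, -109))
      (Leaf (-1, 2) (2, 0) (436, 779, 450) (-825, 558, -82)))
     (Split_shift 20
      (Split_height 90
       (Leaf (-2, 0) (0, -2) (-559, -468, 684) (-696, 711, -94))
       (Leaf (-1, 2) (2, 0) (439, 766, 469) (-829, 551, -89)))
      (Split_shift 28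
       (Split_height 100
        (Leaf (0, 1) (-2, -1) (-577, 410, 706) (627, 766, 140))
        (Leaf (0, 2) (3, -1) (742, 548, 385) (-674, 724, 143)))
       (Split_shift 40
        (Split_height 120
         (Split_shift 32
          (Leaf (2, 0) (0, -3) (633, -549, 544) (622, 782, 18))
          (Split_shift 36
           (Leaf (2, 0) (0, -3) (634, -531, 561) (602, 796, 58))
           (Leaf (0, 2) (3, -1) (699, 520, 490) (-654, 738, 164))))
         (Leaf (3, 0) (0, -4) (723, -630, 282) (641, 767, 24)))
        (Split_shift 44
         (Leaf (3, 0) (0, -4) (678, -616, 400) (646, 762, 21))
         (Leaf (3, 0) (0, -4) (700, -621, 352) (657, 753, -16)))))))"

definition plan_centre :: plan where
  "plan_centre =
    (Split_shift 20
     (Split_height 120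
      (Split_shift 8
       (Leaf (0, -2) (-2, 0) (-480, -480, 733) (707, -707, 0))
       (Split_shift 16
        (Leaf (0, -2) (-2, 0) (-497, -497, 711) (707, -707, 0))
        (Leaf (0, -2) (-2, 0) (-489, -489, 721) (707, -707, 0))))
      (Split_shift 12
       (Leaf (-2, 2) (-2, -2) (-932, 112, 344) (60, 997, -48))
       (Leaf (-2, 1) (-2, -3) (-945, -167, 278) (-116, 989, 82))))
     (Split_shift 24
      (Split_height 100
       (Leaf (0, -2) (-2, 0) (-467, -467, 750) (707, -707, 0))
       (Leaf (2, -1) (0, 2) (787, 516, 337) (549, -835, -28)))
      (Split_shift 28
       (Split_height 100
        (Leaf (0, -2) (-2, 0) (-469, -469, 748) (707, -707, 0))
        (Leaf (3, -1) (0, 3) (757, 576, 307) (606, -795, 3)))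
       (Split_shift 34
        (Split_height 100
         (Split_shift 32
          (Leaf (0, -2) (-2, 0) (-465, -465, 753) (707, -707, 0))
          (Leaf (0, -2) (-2, 0) (-444, -444, 778) (707, -707, 0)))
         (Leaf (3, -1) (0, 3) (755, 578, 308) (626, -777, -59)))
        (Split_shift 38
         (Split_height 90
          (Split_shift 37
           (Leaf (1, -1) (0, 2) (391, 310, 866) (433, -892, 127))
           (Leaf (0, 1) (-2, -1) (-423, 361, 830) (658, 747, 88)))
          (Leaf (3, -1) (0, 3) (743, 570, 350) (624, -779, -59)))
         (Split_shift 40
          (Leaf (3, -1) (0, 3) (729, 558, 395) (623, -780, -54))
          (Split_shift 44
           (Leaf (3, -1) (0, 3) (729, 560, 393) (621, -781, -61))
           (Leaf (3, -1) (0, 3) (724, 553, 412) (617, -782, -82)))))))))"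

definition plan_large_shift :: plan where
  "plan_large_shift =
    (Split_shift 56
     (Leaf (0, -4) (-4, 0) (-664, -664, 343) (707, -707, 0))
     (Split_shift 60
      (Leaf (4, -1) (0, 4) (724, 566, 393) (621, -780, -75))
      (Leaf (0, 5) (-6, 0) (-634, 693, 342) (745, 666, 32))))"

lemma valid_plan_corner: "valid plan_corner (0, 52) (80, 160) (0, 20) (0, 20)"
  by code_simp

lemma valid_plan_edge_x: "valid plan_edge_x (0, 52) (80, 160) (20, 40) (0, 20)"
  by code_simp

lemma valid_plan_edge_y: "valid plan_edge_y (0, 52) (80, 160) (0, 20) (20, 40)"
  by code_simp

lemma valid_plan_centre: "valid plan_centre (0, 52) (80, 160) (20, 40) (20, 40)"
  by code_simp

lemma valid_plan_large_shift: "valid plan_large_shift (52, 80) (80, 160) (0, 40) (0, 40)"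
  by code_simp

lemma valid_plan:
  "valid (Split_shift 52
      (Split_x 20 (Split_y 20 plan_corner plan_edge_y) (Split_y 20 plan_edge_x plan_centre))
      plan_large_shift) (0, 80) (80, 160) (0, 40) (0, 40)"
  using valid_plan_corner valid_plan_edge_x valid_plan_edge_y valid_plan_centre valid_plan_large_shift
  by simp

definition reflect :: "real \<Rightarrow> real \<Rightarrow> point \<Rightarrow> point" where
  "reflect \<sigma> \<tau> v = vector [\<sigma> * v $ 1, \<tau> * v $ 2, v $ 3]"

lemma resolves_reflect:
  assumes "\<bar>\<sigma>\<bar> = 1" "\<bar>\<tau>\<bar> = 1"
  shows "resolves \<beta> (reflect \<sigma> \<tau> \<nu>) (reflect \<sigma> \<tau> D) = resolves \<beta> \<nu> D" "norm (reflect \<sigma> \<tau> \<nu>) = norm \<nu>"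
    "reflect \<sigma> \<tau> (- \<nu>) = - reflect \<sigma> \<tau> \<nu>"
proof -
  have sign: "\<sigma> = 1 \<or> \<sigma> = -1" "\<tau> = 1 \<or> \<tau> = -1" using assms by auto
  have n: "norm (reflect \<sigma> \<tau> v) = norm v" for v
    using sign by (auto simp: norm_point reflect_def vector_3)
  have "reflect \<sigma> \<tau> \<nu> \<bullet> reflect \<sigma> \<tau> D = \<nu> \<bullet> D"
    using sign by (auto simp: inner_vec_def sum_3 reflect_def vector_3)
  then show "resolves \<beta> (reflect \<sigma> \<tau> \<nu>) (reflect \<sigma> \<tau> D) = resolves \<beta> \<nu> D" by (simp add: resolves_def n)
  show "norm (reflect \<sigma> \<tau> \<nu>) = norm \<nu>" by (rule n)
  show "reflect \<sigma> \<tau> (- \<nu>) = - reflect \<sigma> \<tau> \<nu>" by (simp add: vec_eq_iff forall_3 reflect_def vector_3)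
qed

lemma resolves_scale:
  assumes "h > 0"
  shows "resolves (h * \<beta>) \<nu> (h *\<^sub>R D) = resolves \<beta> \<nu> D"
proof -
  have "757 / 1000 * (norm (h *\<^sub>R D))\<^sup>2 / (h * \<beta>) + 2575 / 10000 * norm (h *\<^sub>R D)
      = h * (757 / 1000 * (norm D)\<^sup>2 / \<beta> + 2575 / 10000 * norm D)"
    using assms by (simp add: power_mult_distrib power2_eq_square[of h] distrib_left)
  then show ?thesis using assms by (simp add: resolves_def)
qed

lemma nearest_integer_reflected:
  fixes t :: real
  obtains i \<sigma> :: int where "\<sigma> \<in> {-1, 1}" "in_range (of_int \<sigma> * (of_int i - t)) (0, 40)"
proof -
  have "\<bar>of_int (round t) - t\<bar> \<le> 1 / 2" by (rule of_int_round_abs_le)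
  then show ?thesis
    using that[of 1 "round t"] that[of "-1" "round t"]
    by (cases "of_int (round t) \<ge> t") (auto simp: in_range_def abs_le_iff)
qed

lemma resolves_safe_camera:
  fixes a b c h :: real and g :: point and i j m n \<sigma> \<tau> :: int
  assumes h: "h > 0" and sg: "\<sigma> \<in> {-1, 1}" "\<tau> \<in> {-1, 1}" and g: "g $ 3 = 0"
    and abc: "\<bar>a\<bar> \<le> lam_h * h" "\<bar>b\<bar> \<le> lam_h * h" "\<bar>c\<bar> \<le> lam_v * h"
    and safe: "safe lam_h (1 + lam_v) \<nu> (of_int \<sigma> * (of_int i - g $ 1 / h) + of_int m)
      (of_int \<tau> * (of_int j - g $ 2 / h) + of_int n)"
  shows "resolves (h * (494 / 100 * (1 + lam_v) / (1 - lam_h))) (reflect (of_int \<sigma>) (of_int \<tau>) \<nu>)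
    (vector [of_int (i + \<sigma> * m) * h + a, of_int (j + \<tau> * n) * h + b, h + c] - g)"
proof -
  define \<xi> where "\<xi> = of_int \<sigma> * (of_int i - g $ 1 / h) + of_int m + of_int \<sigma> * (a / h)"
  define \<eta> where "\<eta> = of_int \<tau> * (of_int j - g $ 2 / h) + of_int n + of_int \<tau> * (b / h)"
  define z where "z = 1 + c / h"
  have ab: "\<bar>a / h\<bar> \<le> lam_h" "\<bar>b / h\<bar> \<le> lam_h" "\<bar>c / h\<bar> \<le> lam_v"
    using abc h by (simp_all add: pos_divide_le_eq)
  have "\<bar>of_int \<sigma> * (a / h)\<bar> \<le> lam_h" "\<bar>of_int \<tau> * (b / h)\<bar> \<le> lam_h"
    using ab sg by (auto simp: abs_mult)
  moreover have "2 - (1 + lam_v) \<le> z" "z \<le> 1 + lam_v" using ab(3) unfolding z_def by linarith+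
  ultimately have "resolves (494 / 100 * (1 + lam_v) / (1 - lam_h)) \<nu> (vector [\<xi>, \<eta>, z])"
    using safe unfolding safe_def by (simp add: \<xi>_def \<eta>_def)
  then have "resolves (494 / 100 * (1 + lam_v) / (1 - lam_h)) (reflect (of_int \<sigma>) (of_int \<tau>) \<nu>)
      (reflect (of_int \<sigma>) (of_int \<tau>) (vector [\<xi>, \<eta>, z]))"
    using sg by (subst resolves_reflect(1)) auto
  then have "resolves (h * (494 / 100 * (1 + lam_v) / (1 - lam_h))) (reflect (of_int \<sigma>) (of_int \<tau>) \<nu>)
      (h *\<^sub>R reflect (of_int \<sigma>) (of_int \<tau>) (vector [\<xi>, \<eta>, z]))"
    by (simp only: resolves_scale[OF h])
  moreover have "h *\<^sub>R reflect (of_int \<sigma>) (of_int \<tau>) (vector [\<xi>, \<eta>, z])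
      = vector [of_int (i + \<sigma> * m) * h + a, of_int (j + \<tau> * n) * h + b, h + c] - g"
    using sg h g
    by (auto simp: vec_eq_iff forall_3 reflect_def vector_3 \<xi>_def \<eta>_def z_def field_simps)
  ultimately show ?thesis by simp
qed

theorem theorem5:
  fixes h \<alpha> lam_v lam_h :: real
    and a b c :: "int \<Rightarrow> int \<Rightarrow> real"
    and g :: "real ^ 3"
  assumes "h > 0"
    and "0 < \<alpha>" and "\<alpha> \<le> 0.1"
    and "0 < lam_v" and "lam_v < 1"
    and "0 < lam_h" and "lam_h < 1"
    and "\<And>i j. \<bar>a i j\<bar> \<le> lam_h * h"
    and "\<And>i j. \<bar>b i j\<bar> \<le> lam_h * h"
    and "\<And>i j. \<bar>c i j\<bar> \<le> lam_v * h"
    and "g $ 3 = 0"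
  shows "\<exists>s\<in>{vector [of_int i * h + a i j, of_int j * h + b i j, h + c i j] | i j. True}.
         \<exists>s'\<in>{vector [of_int i * h + a i j, of_int j * h + b i j, h + c i j] | i j. True}.
           loc_err \<alpha> g {s, s'}
             \<le> ereal (2.47 * (1 + lam_v) / (1 - lam_h)) * loc_err \<alpha> g {x :: real ^ 3. x $ 3 = h}"
proof -
  note a = tan_le_of_le_tenth[OF assms(2,3)]
  define cam :: "int \<Rightarrow> int \<Rightarrow> point" where
    "cam i j = vector [of_int i * h + a i j, of_int j * h + b i j, h + c i j]" for i j
  define \<beta> where "\<beta> = h * (494 / 100 * (1 + lam_v) / (1 - lam_h))"
  have \<beta>: "\<beta> > 0" using assms by (simp add: \<beta>_def)
  obtain i \<sigma> where i: "\<sigma> \<in> {-1, 1}" "in_range (of_int \<sigma> * (of_int i - g $ 1 / h)) (0, 40)"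
    by (rule nearest_integer_reflected)
  obtain j \<tau> where j: "\<tau> \<in> {-1, 1}" "in_range (of_int \<tau> * (of_int j - g $ 2 / h)) (0, 40)"
    by (rule nearest_integer_reflected)
  have "in_range lam_h (0, 80)" "in_range (1 + lam_v) (80, 160)" using assms by (simp_all add: in_range_def)
  from valid_sound[OF valid_plan this(1) assms(7) this(2) i(2) j(2)]
  obtain m n m' n' \<nu> \<nu>' where \<nu>: "norm \<nu> \<le> 1" "norm \<nu>' \<le> 1"
    and s1: "safe lam_h (1 + lam_v) \<nu> (of_int \<sigma> * (of_int i - g $ 1 / h) + of_int m) (of_int \<tau> * (of_int j - g $ 2 / h) + of_int n)"
      "safe lam_h (1 + lam_v) \<nu>' (of_int \<sigma> * (of_int i - g $ 1 / h) + of_int m) (of_int \<tau> * (of_int j - g $ 2 / h) + of_int n)"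
    and s2: "safe lam_h (1 + lam_v) \<nu> (of_int \<sigma> * (of_int i - g $ 1 / h) + of_int m') (of_int \<tau> * (of_int j - g $ 2 / h) + of_int n')"
      "safe lam_h (1 + lam_v) (- \<nu>') (of_int \<sigma> * (of_int i - g $ 1 / h) + of_int m') (of_int \<tau> * (of_int j - g $ 2 / h) + of_int n')"
    by blast
  define s s' where "s = cam (i + \<sigma> * m) (j + \<tau> * n)" and "s' = cam (i + \<sigma> * m') (j + \<tau> * n')"
  define \<rho> where "\<rho> = reflect (of_int \<sigma>) (of_int \<tau>)"
  have \<rho>: "norm (\<rho> v) = norm v" "\<rho> (- v) = - \<rho> v" for v
    using resolves_reflect(2,3)[of "of_int \<sigma>" "of_int \<tau>"] i(1) j(1) by (auto simp: \<rho>_def)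
  note camera = resolves_safe_camera[OF assms(1) i(1) j(1) assms(11) assms(8-10)]
  have res: "resolves \<beta> (\<rho> \<nu>) (s - g)" "resolves \<beta> (\<rho> \<nu>') (s - g)"
    "resolves \<beta> (\<rho> \<nu>) (s' - g)" "resolves \<beta> (\<rho> (- \<nu>')) (s' - g)"
    unfolding \<beta>_def \<rho>_def s_def s'_def cam_def
    by (rule camera[OF s1(1)], rule camera[OF s1(2)], rule camera[OF s2(1)], rule camera[OF s2(2)])
  have ne: "cam p q \<noteq> g" for p q
  proof -
    have "- (h + c p q) < 0"
      using assms(10)[of p q] mult_strict_right_mono[OF assms(5,1)] by (simp add: abs_le_iff)
    then show ?thesis using assms(11) by (auto simp: cam_def vec_eq_iff forall_3 vector_3)
  qed
  have "loc_err \<alpha> g {s, s'} \<le> ereal (2 * tan \<alpha> * \<beta> / (1 - tan \<alpha>)\<^sup>2)"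
    by (rule loc_err_pair_le[OF assms(2,3) \<beta>, of "\<rho> \<nu>" "\<rho> \<nu>'"])
      (use res \<nu> \<rho> ne in \<open>auto simp: s_def s'_def\<close>)
  also have "\<dots> = ereal (2.47 * (1 + lam_v) / (1 - lam_h)) * ereal (4 * tan \<alpha> * h / (1 - tan \<alpha>)\<^sup>2)"
  proof -
    have "2 * t * (h * (494 / 100 * x / y)) / q = 2.47 * x / y * (4 * t * h / q)" for t x y q :: real
      by (simp add: divide_simps)
    then show ?thesis by (simp only: \<beta>_def times_ereal.simps)
  qed
  also have "\<dots> \<le> ereal (2.47 * (1 + lam_v) / (1 - lam_h)) * loc_err \<alpha> g {x. x $ 3 = h}"
    using loc_err_plane_ge[OF assms(2) a(5) assms(1,11)] assms by (intro ereal_mult_left_mono) auto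
  finally have "loc_err \<alpha> g {s, s'} \<le> ereal (2.47 * (1 + lam_v) / (1 - lam_h)) * loc_err \<alpha> g {x. x $ 3 = h}" .
  moreover have "cam p q \<in> {vector [of_int i * h + a i j, of_int j * h + b i j, h + c i j] | i j. True}" for p q
    by (auto simp: cam_def)
  ultimately show ?thesis unfolding s_def s'_def by blast
qed

end
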